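(* Let $f,g\in\mathcal{S}(\Omega)$. If $x\in\Omega\cap\mathbb{R}$ then $x\in V(f\cdot g)$ is equivalent to $x\in V(f)\cup V(g)\cup(V({}^{\pi}\!f)\cap V({}^{\pi}\!g))$. If, instead, $x\in\Omega\setminus\mathbb{R}$, then the following statements hold. 1. If $V(f)\supseteq\mathbb{S}_x$ or $V(g)\supseteq\mathbb{S}_x$, then $V(f\cdot g)\supseteq\mathbb{S}_x$. 2. If $V(f)\cap\mathbb{S}_x=T_{y_1}$ and $V(g)\cap\mathbb{S}_x=T_{z_1}$, then $V(f\cdot g)\supseteq\mathbb{S}_x$. 3. Suppose $V(f)\cap\mathbb{S}_x=T_{y_1}$ and $V(g)\cap\mathbb{S}_x=\{z\}$. If $z_1=\mathscr{C}(f'_s(x),y_1^c)$, then $V(f\cdot g)\supseteq\mathbb{S}_x$. Otherwise, $V(f\cdot g)\cap\mathbb{S}_x=T_{y_1}$. 4. Suppose $V(f)\cap\mathbb{S}_x=T_{y_1}$ and $V(g)\cap\mathbb{S}_x=\emptyset$. If $\mathscr{C}(f'_s(x),y_1^c)\in V({}^{\pi}\!g)$, then $V(f\cdot g)\supseteq\mathbb{S}_x$. Otherwise, $V(f\cdot g)\cap\mathbb{S}_x=T_{y_1}$. 5. Suppose $V(f)\cap\mathbb{S}_x=\{y\}$ and $V(g)\cap\mathbb{S}_x=T_{z_1}$. If $z_1=\mathscr{C}(({}^{\pi}\!f)'_s(x_1),y_1^c)$, then $V(f\cdot g)\supseteq\mathbb{S}_x$. Otherwise, $V(f\cdot g)\cap\mathbb{S}_x=T_{y_1}$.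 6. Suppose $V(f)\cap\mathbb{S}_x=\{y\}$ and $V(g)\cap\mathbb{S}_x=\{z\}$. If $z=\mathscr{C}(f'_s(x),y^c)$, then $V(f\cdot g)\supseteq\mathbb{S}_x$. If $z$ is a point of $T_{\mathscr{C}(({}^{\pi}\!f)'_s(x_1),y_1^c)}$ other than $\mathscr{C}(f'_s(x),y^c)$, then $V(f\cdot g)\cap\mathbb{S}_x=T_{y_1}$. Otherwise, $V(f\cdot g)\cap\mathbb{S}_x=\{y\}$. 7. Suppose $V(f)\cap\mathbb{S}_x=\{y\}$ and $V(g)\cap\mathbb{S}_x=\emptyset$. If $\mathscr{C}(({}^{\pi}\!f)'_s(x_1),y_1^c)\in V({}^{\pi}\!g)$, then $V(f\cdot g)\cap\mathbb{S}_x=T_{y_1}$. Otherwise, $V(f\cdot g)\cap\mathbb{S}_x=\{y\}$. 8. Suppose $V(f)\cap\mathbb{S}_x=\emptyset$ and $V(g)\cap\mathbb{S}_x=T_{z_1}$. If $z_1\in V({}^{\pi}\!f^c)$, then $V(f\cdot g)\supseteq\mathbb{S}_x$. Otherwise, $V(f\cdot g)\cap\mathbb{S}_x=T_{\mathscr{C}({}^{\pi}\!f^c(z_1),z_1)}$. 9. Suppose $V(f)\cap\mathbb{S}_x=\emptyset$ and $V(g)\cap\mathbb{S}_x=\{z\}$. If $z_1\in V({}^{\pi}\!f^c)$, then $V(f\cdot g)\cap\mathbb{S}_x=T_{\mathscr{C}(f^c(z),z_1)}$. Otherwise, $V(f\cdot g)\cap\mathbb{S}_x=\{\mathscr{C}(f^c(z),z)\}$.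 10. If $V(f)\cap\mathbb{S}_x=\emptyset$ and $V(g)\cap\mathbb{S}_x=\emptyset$, then $$V(f\cdot g)\cap\mathbb{S}_x=\{y\in\mathbb{S}_x:\ y_1\in V({}^{\pi}\!f),\ \mathscr{C}(f(y),y_1)\in V({}^{\pi}\!g)\}.$$
   Context: $\mathbb{H}$ is the algebra of quaternions, with conjugation $q\mapsto q^c$; $\mathrm{Im}(\mathbb{H})$ is the space of purely imaginary quaternions; $p\perp q$ means $pq^c+qp^c=0$; $\mathbb{H}^*=\mathbb{H}\setminus\{0\}$. The dual quaternions are $\mathbb{DH}=\mathbb{H}+\epsilon\mathbb{H}$, with elements $h=h_1+\epsilon h_2$, componentwise addition and product $hh'=h_1h'_1+\epsilon(h_1h'_2+h_2h'_1)$; $\pi(h)=h_1$ is the primal part (a subscript $1$ denotes the primal part: $x_1,y_1,z_1$ are the primal parts of $x,y,z$). Put $h^c=h_1^c+\epsilon h_2^c$, $t(h)=h+h^c$, $n(h)=hh^c$. For $A=\mathbb{H}$ or $\mathbb{DH}$ let $\mathbb{S}_A=\{J\in A: t(J)=0,\ n(J)=1\}$. Let $Q_{\mathbb{DH}}=\{\alpha+\beta J:\alpha,\beta\in\mathbb{R},\ J\in\mathbb{S}_{\mathbb{DH}}\}$. For $x=\alpha+\beta J\in Q_{\mathbb{DH}}$ put $\mathrm{Im}(x)=\beta J$, $x^c=\alpha-\beta J$ and $\mathbb{S}_x=\alpha+\beta\,\mathbb{S}_{\mathbb{DH}}$. For $x\in Q_{\mathbb{DH}}\setminus\mathbb{R}$,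 $T_{x_1}=\{x_1+\epsilon\gamma:\gamma\in\mathrm{Im}(\mathbb{H}),\ \gamma\perp\mathrm{Im}(x_1)\}\subset\mathbb{S}_x$. In the hypotheses, "$V(f)\cap\mathbb{S}_x=T_{y_1}$" is meant for some $y_1\in\mathbb{S}_x\cap\mathbb{H}$ and "$V(f)\cap\mathbb{S}_x=\{y\}$" for some $y\in\mathbb{S}_x$, and similarly for $g$, $z_1$, $z$. For $h,l\in\mathbb{DH}$, $\mathscr{C}(h,l)$ is defined as $h^{-1}lh$ if $h$ is invertible (i.e. $h_1\ne0$), $h_2^{-1}lh_2$ if $h=\epsilon h_2\in\epsilon\mathbb{H}^*$, and $l$ if $h=0$. Let $D\subseteq\mathbb{C}$ be invariant under complex conjugation and $\Omega=\Omega_D=\{\alpha+\beta J:\alpha,\beta\in\mathbb{R},\ \alpha+i\beta\in D,\ J\in\mathbb{S}_{\mathbb{DH}}\}$. Let $\mathbb{DH}_{\mathbb{C}}=\mathbb{DH}\otimes_{\mathbb{R}}\mathbb{C}=\{a+\iota b: a,b\in\mathbb{DH}\}$, with $\iota^2=-1$, $\iota$ central, and $(a+\iota b)^c=a^c+\iota b^c$. A stem function is $F=F_1+\iota F_2:D\to\mathbb{DH}_{\mathbb{C}}$ with $F_1(\bar z)=F_1(z)$, $F_2(\bar z)=-F_2(z)$; it induces the slice function $f=\mathcal{I}(F):\Omega\to\mathbb{DH}$, $f(\alpha+\beta J)=F_1(\alpha+i\beta)+JF_2(\alpha+i\beta)$. $\mathcal{S}(\Omega)$ is the set of slice functions on $\Omega$.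 For $f=\mathcal{I}(F)$, $g=\mathcal{I}(G)$, put $f\cdot g=\mathcal{I}(FG)$ (pointwise product of stem functions) and $f^c=\mathcal{I}(F^c)$ with $F^c(z)=F(z)^c$. For $x\in\Omega\setminus\mathbb{R}$ the spherical derivative is $f'_s(x)=\frac12\mathrm{Im}(x)^{-1}(f(x)-f(x^c))$, and the same formula defines the spherical derivative of quaternionic slice functions. The primal part of $f=\mathcal{I}(F_1+\iota F_2)$ is the quaternionic slice function ${}^{\pi}\!f:\Omega\cap\mathbb{H}\to\mathbb{H}$, ${}^{\pi}\!f(\alpha+\beta I)=\pi(F_1(\alpha+i\beta))+I\,\pi(F_2(\alpha+i\beta))$ for $I\in\mathbb{S}_{\mathbb{H}}$; ${}^{\pi}\!f^c$ is the primal part of $f^c$. $V(\cdot)$ denotes the zero set of a function in its domain. *)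

theory Defs
  imports Complex_Main
begin

section \<open>Quaternions\<close>

datatype quat = Quat (qre: real) (qi: real) (qj: real) (qk: real)

lemma quat_eq_iff: "p = q \<longleftrightarrow> qre p = qre q \<and> qi p = qi q \<and> qj p = qj q \<and> qk p = qk q"
  by (cases p; cases q) simp

definition qconj :: "quat \<Rightarrow> quat" where
  "qconj q = Quat (qre q) (- qi q) (- qj q) (- qk q)"

lemma qconj_sel [simp]:
  "qre (qconj q) = qre q" "qi (qconj q) = - qi q" "qj (qconj q) = - qj q" "qk (qconj q) = - qk q"
  by (simp_all add: qconj_def)

instantiation quat :: ring_1
begin

definition "0 = Quat 0 0 0 0"
definition "1 = Quat 1 0 0 0"
definition "p + q = Quat (qre p + qre q) (qi p + qi q) (qj p + qj q) (qk p + qk q)"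
definition "- p = Quat (- qre p) (- qi p) (- qj p) (- qk p)"
definition "p - q = Quat (qre p - qre q) (qi p - qi q) (qj p - qj q) (qk p - qk q)"
definition "p * q = Quat
  (qre p * qre q - qi p * qi q - qj p * qj q - qk p * qk q)
  (qre p * qi q + qi p * qre q + qj p * qk q - qk p * qj q)
  (qre p * qj q - qi p * qk q + qj p * qre q + qk p * qi q)
  (qre p * qk q + qi p * qj q - qj p * qi q + qk p * qre q)"

instance
  by standard
    (simp_all add: quat_eq_iff zero_quat_def one_quat_def plus_quat_def uminus_quat_def
      minus_quat_def times_quat_def algebra_simps)

end

lemma quat_sel [simp]:
  "qre 0 = 0" "qi 0 = 0" "qj 0 = 0" "qk 0 = 0"
  "qre 1 = 1" "qi 1 = 0" "qj 1 = 0" "qk 1 = 0"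
  "qre (p + q) = qre p + qre q" "qi (p + q) = qi p + qi q"
  "qj (p + q) = qj p + qj q" "qk (p + q) = qk p + qk q"
  "qre (- p) = - qre p" "qi (- p) = - qi p" "qj (- p) = - qj p" "qk (- p) = - qk p"
  "qre (p - q) = qre p - qre q" "qi (p - q) = qi p - qi q"
  "qj (p - q) = qj p - qj q" "qk (p - q) = qk p - qk q"
  "qre (p * q) = qre p * qre q - qi p * qi q - qj p * qj q - qk p * qk q"
  "qi (p * q) = qre p * qi q + qi p * qre q + qj p * qk q - qk p * qj q"
  "qj (p * q) = qre p * qj q - qi p * qk q + qj p * qre q + qk p * qi q"
  "qk (p * q) = qre p * qk q + qi p * qj q - qj p * qi q + qk p * qre q"
  by (simp_all add: zero_quat_def one_quat_def plus_quat_def uminus_quat_def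
      minus_quat_def times_quat_def)

instantiation quat :: real_algebra_1
begin

definition "r *\<^sub>R q = Quat (r * qre q) (r * qi q) (r * qj q) (r * qk q)"

instance
  by standard (simp_all add: quat_eq_iff scaleR_quat_def algebra_simps)

end

lemma quat_scaleR_sel [simp]:
  "qre (r *\<^sub>R q) = r * qre q" "qi (r *\<^sub>R q) = r * qi q"
  "qj (r *\<^sub>R q) = r * qj q" "qk (r *\<^sub>R q) = r * qk q"
  by (simp_all add: scaleR_quat_def)

lemma quat_normsq_pos:
  assumes "q \<noteq> (0 :: quat)"
  shows "(qre q)\<^sup>2 + (qi q)\<^sup>2 + (qj q)\<^sup>2 + (qk q)\<^sup>2 > 0"
proof -
  have "qre q \<noteq> 0 \<or> qi q \<noteq> 0 \<or> qj q \<noteq> 0 \<or> qk q \<noteq> 0"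
    using assms by (auto simp: quat_eq_iff)
  then have "(qre q)\<^sup>2 > 0 \<or> (qi q)\<^sup>2 > 0 \<or> (qj q)\<^sup>2 > 0 \<or> (qk q)\<^sup>2 > 0"
    by simp
  moreover have "(qre q)\<^sup>2 \<ge> 0" "(qi q)\<^sup>2 \<ge> 0" "(qj q)\<^sup>2 \<ge> 0" "(qk q)\<^sup>2 \<ge> 0"
    by simp_all
  ultimately show ?thesis by linarith
qed

lemma quat_mult_conj:
  "q * qconj q = of_real ((qre q)\<^sup>2 + (qi q)\<^sup>2 + (qj q)\<^sup>2 + (qk q)\<^sup>2)"
  "qconj q * q = of_real ((qre q)\<^sup>2 + (qi q)\<^sup>2 + (qj q)\<^sup>2 + (qk q)\<^sup>2)"
  by (simp_all add: quat_eq_iff of_real_def power2_eq_square algebra_simps)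

instantiation quat :: division_ring
begin

definition "inverse (q :: quat) = (1 / ((qre q)\<^sup>2 + (qi q)\<^sup>2 + (qj q)\<^sup>2 + (qk q)\<^sup>2)) *\<^sub>R qconj q"
definition "p div (q :: quat) = p * inverse q"

instance
proof
  fix q p :: quat
  show "p div q = p * inverse q" by (simp add: divide_quat_def)
  show "inverse (0 :: quat) = 0" by (simp add: inverse_quat_def)
  assume "q \<noteq> 0"
  note pos = quat_normsq_pos[OF this]
  show "inverse q * q = 1" "q * inverse q = 1"
    using pos by (simp_all add: inverse_quat_def quat_mult_conj of_real_def)
qed

end

instance quat :: real_div_algebra ..


section \<open>Dual quaternions\<close>

text \<open>\<open>DQuat h\<^sub>1 h\<^sub>2\<close> is \<open>h\<^sub>1 + \<epsilon> h\<^sub>2\<close>.\<close>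

datatype dquat = DQuat (primal: quat) (dualp: quat)

lemma dquat_eq_iff: "h = l \<longleftrightarrow> primal h = primal l \<and> dualp h = dualp l"
  by (cases h; cases l) simp

instantiation dquat :: ring_1
begin

definition "0 = DQuat 0 0"
definition "1 = DQuat 1 0"
definition "h + l = DQuat (primal h + primal l) (dualp h + dualp l)"
definition "- h = DQuat (- primal h) (- dualp h)"
definition "h - l = DQuat (primal h - primal l) (dualp h - dualp l)"
definition "h * l = DQuat (primal h * primal l) (primal h * dualp l + dualp h * primal l)"

instance
  by standard
    (simp_all add: dquat_eq_iff zero_dquat_def one_dquat_def plus_dquat_def uminus_dquat_def
      minus_dquat_def times_dquat_def algebra_simps)

end

lemma dquat_sel [simp]:
  "primal 0 = 0" "dualp 0 = 0"
  "primal 1 = 1" "dualp 1 = 0"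
  "primal (h + l) = primal h + primal l" "dualp (h + l) = dualp h + dualp l"
  "primal (- h) = - primal h" "dualp (- h) = - dualp h"
  "primal (h - l) = primal h - primal l" "dualp (h - l) = dualp h - dualp l"
  "primal (h * l) = primal h * primal l"
  "dualp (h * l) = primal h * dualp l + dualp h * primal l"
  by (simp_all add: zero_dquat_def one_dquat_def plus_dquat_def uminus_dquat_def
      minus_dquat_def times_dquat_def)

instantiation dquat :: real_algebra_1
begin

definition "r *\<^sub>R h = DQuat (r *\<^sub>R primal h) (r *\<^sub>R dualp h)"

instance
  by standard (simp_all add: dquat_eq_iff scaleR_dquat_def algebra_simps)

end

lemma dquat_scaleR_sel [simp]:
  "primal (r *\<^sub>R h) = r *\<^sub>R primal h" "dualp (r *\<^sub>R h) = r *\<^sub>R dualp h"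
  by (simp_all add: scaleR_dquat_def)

text \<open>Exactly the elements with nonzero primal part are invertible; on the others \<open>inverse\<close> is
  a junk value.\<close>

instantiation dquat :: inverse
begin

definition "inverse (h :: dquat) =
  DQuat (inverse (primal h)) (- (inverse (primal h) * dualp h * inverse (primal h)))"
definition "h div (l :: dquat) = h * inverse l"

instance ..

end

lemma dquat_inverse:
  assumes "primal h \<noteq> 0"
  shows "h * inverse h = 1" "inverse h * h = 1"
  using assms by (simp_all add: dquat_eq_iff inverse_dquat_def mult.assoc[symmetric])
    (simp add: mult.assoc)

lemma dquat_invertible_iff: "(\<exists>k. h * k = 1 \<and> k * h = 1) \<longleftrightarrow> primal h \<noteq> 0"
  by (metis dquat_inverse dquat_sel(1,3,11) mult_zero_left zero_neq_one)

definition of_quat :: "quat \<Rightarrow> dquat" where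
  "of_quat q = DQuat q 0"

definition dual_unit :: dquat ("\<epsilon>") where
  "\<epsilon> = DQuat 0 1"

text \<open>From here on \<open>\<real> \<subseteq> \<bbbH> \<subseteq> \<bbbD>\<bbbH>\<close> are treated as subsets of the type \<^typ>\<open>dquat\<close>; in
  particular the primal part \<open>\<pi> h\<close> is again a \<^typ>\<open>dquat\<close>.\<close>

definition quats :: "dquat set" ("\<bbbH>") where
  "\<bbbH> = range of_quat"

definition im_quats :: "dquat set" where
  "im_quats = {of_quat q | q. qre q = 0}"

definition primal_part :: "dquat \<Rightarrow> dquat" ("\<pi>") where
  "\<pi> h = of_quat (primal h)"

definition dconj :: "dquat \<Rightarrow> dquat" where
  "dconj h = DQuat (qconj (primal h)) (qconj (dualp h))"

definition perp :: "dquat \<Rightarrow> dquat \<Rightarrow> bool" where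
  "perp p q \<longleftrightarrow> p * dconj q + q * dconj p = 0"

definition unit_sphere :: "dquat set \<Rightarrow> dquat set" ("\<S>") where
  "\<S> A = {J \<in> A. J + dconj J = 0 \<and> J * dconj J = 1}"

lemma conj_algebra [simp]:
  "dconj (h + l) = dconj h + dconj l" "dconj (h * l) = dconj l * dconj h"
  "dconj (- h) = - dconj h" "dconj (h - l) = dconj h - dconj l"
  "dconj (r *\<^sub>R h) = r *\<^sub>R dconj h" "dconj (of_real r) = of_real r"
  by (simp_all add: dconj_def dquat_eq_iff quat_eq_iff of_real_def algebra_simps)

text \<open>For \<open>x = \<alpha> + \<beta> J\<close> one has \<open>dconj x = \<alpha> - \<beta> J\<close>, so the next definition gives \<open>\<beta> J\<close>.\<close>

definition imag :: "dquat \<Rightarrow> dquat" where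
  "imag x = (1/2) *\<^sub>R (x - dconj x)"

lemma conj_imag_rep:
  assumes "J \<in> \<S> UNIV"
  shows "dconj (of_real \<alpha> + \<beta> *\<^sub>R J) = of_real \<alpha> - \<beta> *\<^sub>R J"
    and "imag (of_real \<alpha> + \<beta> *\<^sub>R J) = \<beta> *\<^sub>R J"
proof -
  have "dconj J = - J"
    using assms by (simp add: unit_sphere_def eq_neg_iff_add_eq_0 add.commute)
  then show 1: "dconj (of_real \<alpha> + \<beta> *\<^sub>R J) = of_real \<alpha> - \<beta> *\<^sub>R J"
    by simp
  show "imag (of_real \<alpha> + \<beta> *\<^sub>R J) = \<beta> *\<^sub>R J"
    unfolding imag_def 1 by (simp add: scaleR_2[symmetric])
qed

text \<open>\<open>\<S>\<^sub>x = \<alpha> + \<beta> \<S>\<close> for \<open>x = \<alpha> + \<beta> J\<close>; the representation is unique up to \<open>(\<beta>, J) \<mapsto> (-\<beta>, -J)\<close>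
  if \<open>x\<close> is not real.\<close>

definition sphere_of :: "dquat \<Rightarrow> dquat set" where
  "sphere_of x = {of_real \<alpha> + \<beta> *\<^sub>R J' | \<alpha> \<beta> J J'.
     J \<in> \<S> UNIV \<and> J' \<in> \<S> UNIV \<and> x = of_real \<alpha> + \<beta> *\<^sub>R J}"

definition T :: "dquat \<Rightarrow> dquat set" where
  "T p = {p + \<epsilon> * \<gamma> | \<gamma>. \<gamma> \<in> im_quats \<and> perp \<gamma> (imag p)}"

definition \<C> :: "dquat \<Rightarrow> dquat \<Rightarrow> dquat" where
  "\<C> h l =
    (if primal h \<noteq> 0 then inverse h * l * h
     else if h \<noteq> 0 then inverse (of_quat (dualp h)) * l * of_quat (dualp h)
     else l)"


section \<open>The complexified algebra and slice functions\<close>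

text \<open>\<open>DQuatC a b\<close> is \<open>a + \<iota> b\<close>.\<close>

datatype dquatC = DQuatC (re\<iota>: dquat) (im\<iota>: dquat)

lemma dquatC_eq_iff: "u = v \<longleftrightarrow> re\<iota> u = re\<iota> v \<and> im\<iota> u = im\<iota> v"
  by (cases u; cases v) simp

instantiation dquatC :: ring_1
begin

definition "0 = DQuatC 0 0"
definition "1 = DQuatC 1 0"
definition "u + v = DQuatC (re\<iota> u + re\<iota> v) (im\<iota> u + im\<iota> v)"
definition "- u = DQuatC (- re\<iota> u) (- im\<iota> u)"
definition "u - v = DQuatC (re\<iota> u - re\<iota> v) (im\<iota> u - im\<iota> v)"
definition "u * v = DQuatC (re\<iota> u * re\<iota> v - im\<iota> u * im\<iota> v) (re\<iota> u * im\<iota> v + im\<iota> u * re\<iota> v)"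

instance
  by standard
    (simp_all add: dquatC_eq_iff zero_dquatC_def one_dquatC_def plus_dquatC_def uminus_dquatC_def
      minus_dquatC_def times_dquatC_def algebra_simps)

end

definition conjC :: "dquatC \<Rightarrow> dquatC" where
  "conjC u = DQuatC (dconj (re\<iota> u)) (dconj (im\<iota> u))"

definition primalC :: "dquatC \<Rightarrow> dquatC" where
  "primalC u = DQuatC (\<pi> (re\<iota> u)) (\<pi> (im\<iota> u))"

definition \<Omega> :: "complex set \<Rightarrow> dquat set" where
  "\<Omega> D = {of_real \<alpha> + \<beta> *\<^sub>R J | \<alpha> \<beta> J. Complex \<alpha> \<beta> \<in> D \<and> J \<in> \<S> UNIV}"

definition stem :: "complex set \<Rightarrow> (complex \<Rightarrow> dquatC) \<Rightarrow> bool" where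
  "stem D F \<longleftrightarrow> (\<forall>z\<in>D. re\<iota> (F (cnj z)) = re\<iota> (F z) \<and> im\<iota> (F (cnj z)) = - im\<iota> (F z))"

text \<open>\<open>induced A D F\<close> is the function on \<open>A \<inter> \<Omega> D\<close> (with \<open>A\<close> being \<open>UNIV\<close> or \<open>\<bbbH>\<close>) given by
  \<open>\<alpha> + \<beta> J \<mapsto> F\<^sub>1 (\<alpha> + i \<beta>) + J F\<^sub>2 (\<alpha> + i \<beta>)\<close> for \<open>J \<in> \<S> A\<close>. Its values elsewhere are irrelevant.\<close>

definition induced ::
    "dquat set \<Rightarrow> complex set \<Rightarrow> (complex \<Rightarrow> dquatC) \<Rightarrow> dquat \<Rightarrow> dquat" where
  "induced A D F x = (THE v. \<exists>\<alpha> \<beta> J. Complex \<alpha> \<beta> \<in> D \<and> J \<in> \<S> A \<and>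
     x = of_real \<alpha> + \<beta> *\<^sub>R J \<and> v = re\<iota> (F (Complex \<alpha> \<beta>)) + J * im\<iota> (F (Complex \<alpha> \<beta>)))"

text \<open>A slice function on \<open>\<Omega> D\<close> is a total function whose values outside \<open>\<Omega> D\<close> are irrelevant;
  its stem function is determined on \<open>D\<close> only.\<close>

definition slice_functions :: "complex set \<Rightarrow> (dquat \<Rightarrow> dquat) set" where
  "slice_functions D = {f. \<exists>F. stem D F \<and> (\<forall>x \<in> \<Omega> D. f x = induced UNIV D F x)}"

definition stem_of :: "complex set \<Rightarrow> (dquat \<Rightarrow> dquat) \<Rightarrow> complex \<Rightarrow> dquatC" where
  "stem_of D f = (SOME F. stem D F \<and> (\<forall>x \<in> \<Omega> D. f x = induced UNIV D F x))"

definition slice_mult ::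
    "complex set \<Rightarrow> (dquat \<Rightarrow> dquat) \<Rightarrow> (dquat \<Rightarrow> dquat) \<Rightarrow> dquat \<Rightarrow> dquat" where
  "slice_mult D f g = induced UNIV D (\<lambda>z. stem_of D f z * stem_of D g z)"

definition slice_conj :: "complex set \<Rightarrow> (dquat \<Rightarrow> dquat) \<Rightarrow> dquat \<Rightarrow> dquat" where
  "slice_conj D f = induced UNIV D (\<lambda>z. conjC (stem_of D f z))"

definition slice_primal :: "complex set \<Rightarrow> (dquat \<Rightarrow> dquat) \<Rightarrow> dquat \<Rightarrow> dquat" where
  "slice_primal D f = induced \<bbbH> D (\<lambda>z. primalC (stem_of D f z))"

definition spherical_deriv :: "(dquat \<Rightarrow> dquat) \<Rightarrow> dquat \<Rightarrow> dquat" where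
  "spherical_deriv f x = (1/2) *\<^sub>R (inverse (imag x) * (f x - f (dconj x)))"

text \<open>Zero sets of functions with domain \<open>\<Omega> D\<close>, respectively \<open>\<Omega> D \<inter> \<bbbH>\<close>.\<close>

definition V :: "complex set \<Rightarrow> (dquat \<Rightarrow> dquat) \<Rightarrow> dquat set" where
  "V D f = {x \<in> \<Omega> D. f x = 0}"

definition V\<^sub>\<pi> :: "complex set \<Rightarrow> (dquat \<Rightarrow> dquat) \<Rightarrow> dquat set" where
  "V\<^sub>\<pi> D f = {x \<in> \<Omega> D \<inter> \<bbbH>. f x = 0}"


section \<open>Well-definedness\<close>

lemma unit_sphere_rep_unique:
  assumes "J \<in> \<S> UNIV" "J' \<in> \<S> UNIV" and eq: "of_real \<alpha> + \<beta> *\<^sub>R J = of_real \<alpha>' + \<beta>' *\<^sub>R J'"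
  shows "\<alpha>' = \<alpha>" and "\<beta>' = 0 \<and> \<beta> = 0 \<or> \<beta>' = \<beta> \<and> J' = J \<or> \<beta>' = - \<beta> \<and> J' = - J"
proof -
  have *: "x + dconj x = of_real (2 * a) \<and> imag x = b *\<^sub>R K \<and> imag x * dconj (imag x) = of_real (b * b)"
    if "K \<in> \<S> UNIV" "x = of_real a + b *\<^sub>R K" for x a b K
  proof -
    have "K * dconj K = 1" using that(1) by (simp add: unit_sphere_def)
    moreover have "of_real (2 * a) = of_real a + (of_real a :: dquat)"
      unfolding mult_2 by (rule of_real_add)
    ultimately show ?thesis
      unfolding that(2) conj_imag_rep[OF that(1)] by (simp add: of_real_def)
  qed
  note 1 = *[OF assms(1) refl, of \<alpha> \<beta>] and 2 = *[OF assms(2) eq]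
  from 1 2 have "of_real (2 * \<alpha>) = (of_real (2 * \<alpha>') :: dquat)" by argo
  then show "\<alpha>' = \<alpha>" by (simp only: of_real_eq_iff)
  from 1 2 have "of_real (\<beta> * \<beta>) = (of_real (\<beta>' * \<beta>') :: dquat)" by argo
  then have "\<beta> * \<beta> = \<beta>' * \<beta>'" by (simp only: of_real_eq_iff)
  then have cases: "\<beta>' = \<beta> \<or> \<beta>' = - \<beta>" unfolding square_eq_iff by auto
  have im: "\<beta> *\<^sub>R J = \<beta>' *\<^sub>R J'" using 1 2 by argo
  from cases show "\<beta>' = 0 \<and> \<beta> = 0 \<or> \<beta>' = \<beta> \<and> J' = J \<or> \<beta>' = - \<beta> \<and> J' = - J"
  proof (elim disjE)
    assume "\<beta>' = \<beta>"
    with im show ?thesis by (cases "\<beta> = 0") auto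
  next
    assume b: "\<beta>' = - \<beta>"
    with im have "\<beta> *\<^sub>R J = \<beta> *\<^sub>R (- J')" by simp
    then have "\<beta> = 0 \<or> J = - J'" by (metis scaleR_cancel_left)
    with b show ?thesis by auto
  qed
qed

lemma induced_apply:
  assumes "stem D F" "Complex \<alpha> \<beta> \<in> D" "J \<in> \<S> A"
  shows "induced A D F (of_real \<alpha> + \<beta> *\<^sub>R J) =
    re\<iota> (F (Complex \<alpha> \<beta>)) + J * im\<iota> (F (Complex \<alpha> \<beta>))"
  unfolding induced_def
proof (rule the_equality)
  show "\<exists>\<alpha>' \<beta>' J'. Complex \<alpha>' \<beta>' \<in> D \<and> J' \<in> \<S> A \<and>
      of_real \<alpha> + \<beta> *\<^sub>R J = of_real \<alpha>' + \<beta>' *\<^sub>R J' \<and>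
      re\<iota> (F (Complex \<alpha> \<beta>)) + J * im\<iota> (F (Complex \<alpha> \<beta>)) =
      re\<iota> (F (Complex \<alpha>' \<beta>')) + J' * im\<iota> (F (Complex \<alpha>' \<beta>'))"
    using assms by blast
next
  fix v
  assume "\<exists>\<alpha>' \<beta>' J'. Complex \<alpha>' \<beta>' \<in> D \<and> J' \<in> \<S> A \<and>
      of_real \<alpha> + \<beta> *\<^sub>R J = of_real \<alpha>' + \<beta>' *\<^sub>R J' \<and>
      v = re\<iota> (F (Complex \<alpha>' \<beta>')) + J' * im\<iota> (F (Complex \<alpha>' \<beta>'))"
  then obtain \<alpha>' \<beta>' J' where *: "J' \<in> \<S> A"
      "of_real \<alpha> + \<beta> *\<^sub>R J = of_real \<alpha>' + \<beta>' *\<^sub>R J'"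
      "v = re\<iota> (F (Complex \<alpha>' \<beta>')) + J' * im\<iota> (F (Complex \<alpha>' \<beta>'))" by blast
  have S: "J \<in> \<S> UNIV" "J' \<in> \<S> UNIV" using assms * by (auto simp: unit_sphere_def)
  have st: "re\<iota> (F (Complex \<alpha> (- \<beta>))) = re\<iota> (F (Complex \<alpha> \<beta>))"
    "im\<iota> (F (Complex \<alpha> (- \<beta>))) = - im\<iota> (F (Complex \<alpha> \<beta>))"
    using assms(1,2) unfolding stem_def by (metis complex_cnj)+
  have zero: "im\<iota> (F (Complex \<alpha> \<beta>)) = 0" if "\<beta> = 0"
  proof -
    from st(2) that have "2 *\<^sub>R im\<iota> (F (Complex \<alpha> \<beta>)) = 0"
      by (simp add: scaleR_2 eq_neg_iff_add_eq_0)
    then show ?thesis by simp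
  qed
  from unit_sphere_rep_unique[OF S *(2)]
  show "v = re\<iota> (F (Complex \<alpha> \<beta>)) + J * im\<iota> (F (Complex \<alpha> \<beta>))"
    using *(3) st zero by auto
qed

lemma unit_sphere_nonempty: "of_quat (Quat 0 1 0 0) \<in> \<S> \<bbbH>"
  by (auto simp: unit_sphere_def quats_def of_quat_def dconj_def dquat_eq_iff quat_eq_iff)

lemma stem_unique:
  assumes "stem D F" "stem D G" "\<forall>x \<in> \<Omega> D. induced UNIV D F x = induced UNIV D G x"
    and D: "cnj ` D = D" and z: "z \<in> D"
  shows "F z = G z"
proof -
  define J where "J = of_quat (Quat 0 1 0 0)"
  have J: "J \<in> \<S> UNIV" "- J \<in> \<S> UNIV"
    by (simp_all add: J_def unit_sphere_def of_quat_def dconj_def dquat_eq_iff quat_eq_iff)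
  obtain \<alpha> \<beta> where zz: "z = Complex \<alpha> \<beta>" by (cases z)
  have in\<Omega>: "of_real \<alpha> + \<beta> *\<^sub>R K \<in> \<Omega> D" if "K \<in> \<S> UNIV" for K
    using that z zz unfolding \<Omega>_def by blast
  have eq: "re\<iota> (F z) + K * im\<iota> (F z) = re\<iota> (G z) + K * im\<iota> (G z)" if "K \<in> \<S> UNIV" for K
    using induced_apply[OF assms(1) z[unfolded zz] that]
      induced_apply[OF assms(2) z[unfolded zz] that] assms(3) in\<Omega>[OF that] zz by simp
  define d e where "d = re\<iota> (F z) - re\<iota> (G z)" and "e = im\<iota> (F z) - im\<iota> (G z)"
  have "d + K * e = 0" if "K \<in> \<S> UNIV" for K
    using eq[OF that] unfolding d_def e_def right_diff_distrib
    by (metis add_diff_add diff_self)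
  then have 1: "d + J * e = 0" "d + (- J) * e = 0"
    using J by blast+
  then have "d + d + (J * e + (- J) * e) = 0"
    by (metis add.assoc add.left_commute add_0_right)
  then have "2 *\<^sub>R d = 0" unfolding scaleR_2 by simp
  then have d: "d = 0" by simp
  have "J * e = 0" using 1(1) unfolding d by simp
  moreover have "J * J = - 1"
    by (simp add: J_def of_quat_def dquat_eq_iff quat_eq_iff)
  moreover have "(J * J) * e = J * (J * e)" by (rule mult.assoc)
  ultimately have "- e = 0" by (metis mult_minus1 mult_zero_right)
  then have "e = 0" by simp
  with d have "re\<iota> (F z) = re\<iota> (G z)" "im\<iota> (F z) = im\<iota> (G z)"
    unfolding d_def e_def by (simp_all only: right_minus_eq)
  then show ?thesis unfolding dquatC_eq_iff by blast
qed

lemma stem_of: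
  assumes "f \<in> slice_functions D"
  shows "stem D (stem_of D f)" "\<forall>x \<in> \<Omega> D. f x = induced UNIV D (stem_of D f) x"
proof -
  have "\<exists>F. stem D F \<and> (\<forall>x \<in> \<Omega> D. f x = induced UNIV D F x)"
    using assms by (simp add: slice_functions_def)
  from someI_ex[OF this] show "stem D (stem_of D f)" "\<forall>x \<in> \<Omega> D. f x = induced UNIV D (stem_of D f) x"
    unfolding stem_of_def by blast+
qed

lemma sphere_of_rep:
  assumes "J \<in> \<S> UNIV"
  shows "sphere_of (of_real \<alpha> + \<beta> *\<^sub>R J) = {of_real \<alpha> + \<beta> *\<^sub>R J' | J'. J' \<in> \<S> UNIV}"
proof (rule set_eqI, rule iffI)
  fix w
  assume "w \<in> sphere_of (of_real \<alpha> + \<beta> *\<^sub>R J)"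
  then obtain \<alpha>' \<beta>' K K' where *: "w = of_real \<alpha>' + \<beta>' *\<^sub>R K'" "K \<in> \<S> UNIV" "K' \<in> \<S> UNIV"
      "of_real \<alpha> + \<beta> *\<^sub>R J = of_real \<alpha>' + \<beta>' *\<^sub>R K"
    unfolding sphere_of_def by blast
  have "dconj K' = - K'"
    using *(3) by (simp add: unit_sphere_def eq_neg_iff_add_eq_0 add.commute)
  then have mem: "- K' \<in> \<S> UNIV"
    using *(3) by (simp add: unit_sphere_def)
  show "w \<in> {of_real \<alpha> + \<beta> *\<^sub>R J' | J'. J' \<in> \<S> UNIV}"
  proof (cases "\<beta>' = - \<beta>")
    case True
    then have "w = of_real \<alpha> + \<beta> *\<^sub>R (- K')"
      using *(1) unit_sphere_rep_unique(1)[OF assms *(2,4)] by simp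
    with mem show ?thesis by blast
  next
    case False
    then have "w = of_real \<alpha> + \<beta> *\<^sub>R K'"
      using *(1) unit_sphere_rep_unique[OF assms *(2,4)] by auto
    with *(3) show ?thesis by blast
  qed
qed (use assms in \<open>unfold sphere_of_def, blast\<close>)

end

theory Submission
  imports Defs
begin

text \<open>On the sphere \<open>\<alpha> + \<beta> \<S>\<close> with \<open>\<beta> \<noteq> 0\<close>, let \<open>f\<close> and \<open>g\<close> be \<open>J \<mapsto> a + J b\<close> and \<open>J \<mapsto> c + J d\<close>. If
  \<open>f\<close> vanishes at \<open>J\<close> then \<open>f \<cdot> g\<close> takes the value \<open>(K - J) b (c + \<C>(b, J\<^sup>c) d)\<close> at \<open>K\<close>. If \<open>g\<close>
  vanishes at \<open>Z\<close> then its value is \<open>(K n - n Z) d\<close> with \<open>n\<^sup>c\<close> the value of \<open>f\<^sup>c\<close> at \<open>Z\<close>. In general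
  its value at \<open>K\<close> is \<open>q (c + \<C>(q, K) d)\<close>, where \<open>q = a + K b\<close>. Since a product of dual
  quaternions vanishes only if a factor does or both primal parts do, the zeros of \<open>f \<cdot> g\<close> can be
  read off; a zero set \<open>T\<close> is characterised by \<open>b\<close> being a nonzero multiple of \<open>\<epsilon>\<close>.\<close>

section \<open>Arithmetic of dual quaternions\<close>

text \<open>If \<open>qre p \<noteq> 0\<close>, the imaginary components
  \<open>2 * (qre p * qi p)\<close> and so on force \<open>p\<close> to be real, and a real square
  is not negative.\<close>

lemma quat_square_eq_minus_one:
  "(p :: quat) * p = - 1 \<longleftrightarrow> qre p = 0 \<and> (qi p)\<^sup>2 + (qj p)\<^sup>2 + (qk p)\<^sup>2 = 1"
proof
  assume eq: "p * p = - 1"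
  then have re: "(qre p)\<^sup>2 - (qi p)\<^sup>2 - (qj p)\<^sup>2 - (qk p)\<^sup>2 = - 1"
    by (simp add: quat_eq_iff power2_eq_square)
  have "qre p = 0"
  proof (rule ccontr)
    assume "qre p \<noteq> 0"
    moreover have "2 * (qre p * qi p) = 0" "2 * (qre p * qj p) = 0" "2 * (qre p * qk p) = 0"
      using eq unfolding quat_eq_iff by auto
    ultimately have "(qre p)\<^sup>2 = - 1" using re by simp
    then show False by (metis not_one_le_zero neg_0_le_iff_le zero_le_power2)
  qed
  with re show "qre p = 0 \<and> (qi p)\<^sup>2 + (qj p)\<^sup>2 + (qk p)\<^sup>2 = 1" by simp
qed (simp add: quat_eq_iff power2_eq_square)

text \<open>As \<open>p\<close> is an imaginary unit, the imaginary part of the anticommutator is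
  \<open>2 * qre q\<close> times \<open>p\<close>, and its real part is minus twice a scalar
  product. This handles the dual component of \<open>J * J\<close>.\<close>

lemma quat_anticommute_iff:
  assumes "(p :: quat) * p = - 1"
  shows "p * q + q * p = 0 \<longleftrightarrow> qre q = 0 \<and> qi p * qi q + qj p * qj q + qk p * qk q = 0"
proof -
  have p: "qre p = 0" "(qi p)\<^sup>2 + (qj p)\<^sup>2 + (qk p)\<^sup>2 = 1"
    using assms by (auto simp: quat_square_eq_minus_one)
  then have "qi p \<noteq> 0 \<or> qj p \<noteq> 0 \<or> qk p \<noteq> 0" by auto
  moreover have "qre (p * q + q * p) = - 2 * (qi p * qi q + qj p * qj q + qk p * qk q)"
    "qi (p * q + q * p) = 2 * qre q * qi p" "qj (p * q + q * p) = 2 * qre q * qj p"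
    "qk (p * q + q * p) = 2 * qre q * qk p"
    using p(1) by (simp_all add: algebra_simps)
  ultimately show ?thesis
    unfolding quat_eq_iff by (auto simp del: quat_sel(7-24) simp: quat_sel(1-6))
qed

text \<open>In these coordinates the sphere is the tangent bundle of the unit 2-sphere, with base
  point \<open>p\<close> and tangent vector \<open>q\<close>.\<close>

lemma unit_sphere_coords:
  "DQuat p q \<in> \<S> UNIV \<longleftrightarrow> qre p = 0 \<and> qre q = 0 \<and> (qi p)\<^sup>2 + (qj p)\<^sup>2 + (qk p)\<^sup>2 = 1 \<and>
     qi p * qi q + qj p * qj q + qk p * qk q = 0"
proof -
  have "DQuat p q + dconj (DQuat p q) = 0 \<longleftrightarrow> qre p = 0 \<and> qre q = 0"
    by (auto simp: dconj_def dquat_eq_iff quat_eq_iff)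
  moreover have "DQuat p q * dconj (DQuat p q) = 1 \<longleftrightarrow>
      (qi p)\<^sup>2 + (qj p)\<^sup>2 + (qk p)\<^sup>2 = 1 \<and> 2 * (qi p * qi q + qj p * qj q + qk p * qk q) = 0"
    if "qre p = 0" "qre q = 0"
    using that by (simp add: dconj_def dquat_eq_iff quat_eq_iff power2_eq_square algebra_simps)
  ultimately show ?thesis by (auto simp: unit_sphere_def)
qed

text \<open>This form makes closure under negation, primal part and conjugation by an invertible
  element immediate.\<close>

lemma unit_sphere_iff: "J \<in> \<S> UNIV \<longleftrightarrow> J * J = - 1"
proof -
  obtain p q where J: "J = DQuat p q" by (cases J)
  have "J * J = - 1 \<longleftrightarrow> p * p = - 1 \<and> p * q + q * p = 0"
    by (simp add: J dquat_eq_iff)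
  also have "\<dots> \<longleftrightarrow> J \<in> \<S> UNIV"
    unfolding J unit_sphere_coords using quat_anticommute_iff[of p q] quat_square_eq_minus_one[of p]
    by blast
  finally show ?thesis ..
qed

text \<open>Quaternions have no zero divisors, so the primal component kills one primal part; the
  dual component is then a single product. The third alternative reflects that
  \<open>\<epsilon>\<close> squares to zero.\<close>

lemma dquat_mult_eq_0_iff:
  "(x :: dquat) * y = 0 \<longleftrightarrow> x = 0 \<or> y = 0 \<or> primal x = 0 \<and> primal y = 0"
  by (auto simp: dquat_eq_iff)

lemma dquat_inverse_conjugate_iff:
  assumes "primal m \<noteq> 0"
  shows "K = inverse m * Z * m \<longleftrightarrow> m * K = Z * m"
  using dquat_inverse[OF assms] by (metis mult.assoc mult_1)

lemma primal_of_quat [simp]: "primal (of_quat q) = q" "dualp (of_quat q) = 0"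
  by (simp_all add: of_quat_def)

lemma primal_part_simps [simp]:
  "primal (\<pi> h) = primal h" "dualp (\<pi> h) = 0"
  "\<pi> (h + l) = \<pi> h + \<pi> l" "\<pi> (- h) = - \<pi> h" "\<pi> (r *\<^sub>R h) = r *\<^sub>R \<pi> h"
  "\<pi> (of_real r) = of_real r" "\<pi> (h * l) = \<pi> h * \<pi> l" "\<pi> (h - l) = \<pi> h - \<pi> l"
  by (simp_all add: primal_part_def dquat_eq_iff of_real_def)

lemma primal_part_eq_0_iff: "\<pi> h = 0 \<longleftrightarrow> primal h = 0"
  by (simp add: dquat_eq_iff)

lemma quats_iff: "h \<in> \<bbbH> \<longleftrightarrow> \<pi> h = h"
  unfolding quats_def primal_part_def by (metis primal_of_quat(1) rangeE rangeI)

lemma unit_sphere_quats: "\<S> \<bbbH> = \<S> UNIV \<inter> \<bbbH>"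
  by (auto simp: unit_sphere_def)

lemma primal_part_unit_sphere:
  assumes "J \<in> \<S> UNIV"
  shows "\<pi> J \<in> \<S> UNIV" "\<pi> J \<in> \<bbbH>"
  using assms by (simp_all add: unit_sphere_iff quats_iff dquat_eq_iff)

lemma uminus_unit_sphere: "J \<in> \<S> UNIV \<Longrightarrow> - J \<in> \<S> UNIV"
  by (simp add: unit_sphere_iff)

lemma dconj_unit_sphere: "J \<in> \<S> UNIV \<Longrightarrow> dconj J = - J"
  by (simp add: unit_sphere_def eq_neg_iff_add_eq_0 add.commute)

section \<open>The conjugation operator \<open>\<C>\<close>\<close>

lemma \<C>_invertible:
  assumes "primal h \<noteq> 0"
  shows "\<C> h l = inverse h * l * h" "h * \<C> h l = l * h"
  using dquat_inverse[OF assms] assms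
  by (simp_all add: \<C>_def) (metis mult.assoc mult_1)

text \<open>Multiplying a multiple of \<open>\<epsilon>\<close> by \<open>k\<close> involves only
  the primal part of \<open>k\<close>, so an identity between primal parts is enough.\<close>

lemma \<C>_dual:
  assumes "primal h = 0" "h \<noteq> 0"
  shows "\<C> h l = inverse (of_quat (dualp h)) * l * of_quat (dualp h)"
    and "h * \<C> h l = l * h"
    and "dualp h * primal (\<C> h l) = primal l * dualp h"
proof -
  show 1: "\<C> h l = inverse (of_quat (dualp h)) * l * of_quat (dualp h)"
    using assms by (simp add: \<C>_def)
  have "dualp h \<noteq> 0" using assms by (simp add: dquat_eq_iff)
  then show "dualp h * primal (\<C> h l) = primal l * dualp h"
    unfolding 1 by (simp add: inverse_dquat_def mult.assoc[symmetric])
  then show "h * \<C> h l = l * h" using assms(1) by (simp add: dquat_eq_iff)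
qed

text \<open>All three branches of \<open>\<C>\<close> are covered; for \<open>h = 0\<close> both
  sides vanish. The identity turns \<open>h * c + l * h * d\<close> into
  \<open>h * (c + \<C> h l * d)\<close>.\<close>

lemma \<C>_mult: "h * \<C> h l = l * h"
  using \<C>_invertible(2) \<C>_dual(2) by (cases "primal h = 0"; cases "h = 0") (auto simp: \<C>_def)

section \<open>Zeros of affine functions on the unit sphere\<close>

text \<open>A slice function restricted to a sphere \<open>\<alpha> + \<beta> \<S>\<close> is \<open>J \<mapsto> a + J b\<close>, where \<open>a + \<iota> b\<close> is the
  value of its stem function; \<open>fibre J\<close> corresponds to \<open>T\<close>.\<close>

definition zeros :: "dquat \<Rightarrow> dquat \<Rightarrow> dquat set" where
  "zeros a b = {J \<in> \<S> UNIV. a + J * b = 0}"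

definition fibre :: "dquat \<Rightarrow> dquat set" where
  "fibre J = {K \<in> \<S> UNIV. primal K = primal J}"

text \<open>A nonzero tangent vector added to the dual part gives another point. This separates
  fibres from singletons.\<close>

lemma ex_fibre_neq:
  assumes "J \<in> \<S> UNIV"
  shows "\<exists>K \<in> fibre J. K \<noteq> J"
proof -
  obtain p q where J: "J = DQuat p q" by (cases J)
  have p: "qre p = 0" "qre q = 0" "(qi p)\<^sup>2 + (qj p)\<^sup>2 + (qk p)\<^sup>2 = 1"
    and pq: "qi p * qi q + qj p * qj q + qk p * qk q = 0"
    using assms by (simp_all add: J unit_sphere_coords)
  \<comment> \<open>A nonzero vector orthogonal to \<open>p\<close>: a quarter turn in the first two
    imaginary coordinates, or the unit \<open>i\<close> if both vanish.\<close>
  define r where "r = (if qi p = 0 \<and> qj p = 0 then Quat 0 1 0 0 else Quat 0 (- qj p) (qi p) 0)"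
  have "r \<noteq> 0" by (auto simp: r_def quat_eq_iff)
  moreover have "DQuat p (q + r) \<in> \<S> UNIV"
    using p pq by (auto simp: unit_sphere_coords r_def algebra_simps)
  ultimately show ?thesis by (intro bexI[of _ "DQuat p (q + r)"]) (simp_all add: J fibre_def)
qed

lemma fibre_self: "J \<in> \<S> UNIV \<Longrightarrow> J \<in> fibre J"
  by (simp add: fibre_def)

text \<open>The point \<open>- J\<close> is missing, because \<open>primal J\<close> squares to
  \<open>- 1\<close> and so is nonzero.\<close>

lemma fibre_neq_sphere:
  assumes "J \<in> \<S> UNIV"
  shows "fibre J \<noteq> \<S> UNIV"
proof
  assume "fibre J = \<S> UNIV"
  then have "primal (- J) = primal J"
    using uminus_unit_sphere[OF assms] unfolding fibre_def by blast
  then have "primal J = 0" by (auto simp: quat_eq_iff)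
  moreover have "primal J * primal J = - 1"
    using assms by (simp add: unit_sphere_iff dquat_eq_iff)
  ultimately show False by simp
qed

text \<open>Evaluation at \<open>J\<close> and \<open>- J\<close> separates \<open>a\<close> from
  \<open>J * b\<close>.\<close>

lemma zeros_eq_sphere_iff: "zeros a b = \<S> UNIV \<longleftrightarrow> a = 0 \<and> b = 0"
proof
  assume eq: "zeros a b = \<S> UNIV"
  obtain J where J: "J \<in> \<S> UNIV" using unit_sphere_nonempty by (auto simp: unit_sphere_quats)
  have "J \<in> zeros a b" "- J \<in> zeros a b" using eq J uminus_unit_sphere[OF J] by simp_all
  then have *: "a + J * b = 0" "a - J * b = 0" by (simp_all add: zeros_def)
  then have "2 *\<^sub>R a = 0" unfolding scaleR_2 by (metis add_0 add_diff_cancel_left' add_diff_eq diff_0_right eq_diff_eq)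
  then have a: "a = 0" by simp
  with *(1) have "J * (J * b) = 0" by simp
  then have "b = 0" using J unfolding mult.assoc[symmetric] by (simp add: unit_sphere_iff)
  with a show "a = 0 \<and> b = 0" by blast
qed (simp add: zeros_def)

text \<open>The nonzero difference of two zeros annihilates \<open>b\<close>, so \<open>b\<close> is
  not invertible; \<open>b = 0\<close> would make the whole sphere vanish.\<close>

lemma zeros_fibre:
  assumes J: "J \<in> \<S> UNIV" and eq: "zeros a b = fibre J"
  shows "primal a = 0" "primal b = 0" "b \<noteq> 0"
proof -
  obtain K where K: "K \<in> fibre J" "K \<noteq> J" using ex_fibre_neq[OF J] by blast
  have *: "a + J * b = 0" "a + K * b = 0"
    using K(1) fibre_self[OF J] eq by (auto simp: zeros_def)
  then have "(K - J) * b = 0" unfolding left_diff_distrib by (metis add_left_cancel right_minus_eq)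
  then show b: "primal b = 0" using K(2) by (auto simp: dquat_mult_eq_0_iff)
  with * show "primal a = 0" by (auto simp: dquat_eq_iff)
  show "b \<noteq> 0"
  proof
    assume "b = 0"
    with *(1) have "zeros a b = \<S> UNIV" by (simp add: zeros_eq_sphere_iff)
    with eq fibre_neq_sphere[OF J] show False by simp
  qed
qed

text \<open>For \<open>b\<close> a multiple of \<open>\<epsilon>\<close>, the product
  \<open>J * b\<close> depends only on \<open>primal J\<close>.\<close>

lemma zeros_dual:
  assumes "primal b = 0" "K \<in> fibre J" "J \<in> zeros a b"
  shows "K \<in> zeros a b"
  using assms by (auto simp: zeros_def fibre_def dquat_eq_iff)

text \<open>With \<open>primal b = 0\<close> the zero would bring along its fibre, which has a
  second point.\<close>

lemma zeros_singleton:
  assumes "zeros a b = {J}"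
  shows "J \<in> \<S> UNIV" "primal b \<noteq> 0" "a + J * b = 0"
proof -
  have J: "J \<in> zeros a b" using assms by simp
  then show 1: "J \<in> \<S> UNIV" "a + J * b = 0" by (simp_all add: zeros_def)
  show "primal b \<noteq> 0"
    using ex_fibre_neq[OF 1(1)] zeros_dual[OF _ _ J] assms by blast
qed

section \<open>Products with a known zero of one factor\<close>

lemma unit_square:
  assumes "J \<in> \<S> UNIV"
  shows "J * J = - 1" "J * (J * x) = - x"
  using assms unfolding mult.assoc[symmetric] by (simp_all add: unit_sphere_iff)

text \<open>\<open>J\<close> being a zero of the first factor, \<open>K - J\<close> splits off from the product on the left.\<close>

lemma zeros_mult_left:
  fixes a b c d :: dquat
  assumes "J \<in> \<S> UNIV" "a + J * b = 0"
  defines "m \<equiv> b * c - J * (b * d)"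
  shows "zeros (a * c - b * d) (a * d + b * c) =
    (if m = 0 then \<S> UNIV else if primal m = 0 then fibre J else {J})"
proof -
  have a: "a = - (J * b)" using assms(2) by (simp add: eq_neg_iff_add_eq_0)
  have "a * c - b * d + K * (a * d + b * c) = (K - J) * m" for K
    using unit_square[OF assms(1)]
    by (simp add: a m_def algebra_simps)
  then show ?thesis
    using assms(1) by (auto simp: zeros_def fibre_def dquat_mult_eq_0_iff)
qed

text \<open>If \<open>Z\<close> is a zero of the second factor, the product at \<open>K\<close> is \<open>(K n - n Z) d\<close>, where
  \<open>n\<close> is the conjugate of the \<open>m\<close> below.\<close>

lemma zeros_mult_right:
  fixes a b c d :: dquat
  assumes "Z \<in> \<S> UNIV" "c + Z * d = 0"
  defines "m \<equiv> dconj a + Z * dconj b"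
  shows "zeros (a * c - b * d) (a * d + b * c) =
    {K \<in> \<S> UNIV. d = 0 \<or> m * K = Z * m \<or> primal d = 0 \<and> primal m * primal K = primal Z * primal m}"
proof -
  have c: "c = - (Z * d)" using assms(2) by (simp add: eq_neg_iff_add_eq_0)
  define n where "n = a - b * Z"
  have dd: "dconj (dconj h) = h" for h by (simp add: dconj_def dquat_eq_iff quat_eq_iff)
  have m: "m = dconj n" using dconj_unit_sphere[OF assms(1)] by (simp add: m_def n_def)
  have prod: "a * c - b * d + K * (a * d + b * c) = (K * n - n * Z) * d" for K
    using unit_square[OF assms(1)] by (simp add: c n_def algebra_simps)
  \<comment> \<open>Conjugation reverses products and negates \<open>K\<close> and \<open>Z\<close>;
    it turns \<open>n\<close> into \<open>m\<close>.\<close>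
  have conj: "dconj (K * n - n * Z) = Z * m - m * K" if "K \<in> \<S> UNIV" for K
    using that assms(1) by (simp add: m dconj_unit_sphere)
  have 1: "K * n - n * Z = 0 \<longleftrightarrow> m * K = Z * m" if "K \<in> \<S> UNIV" for K
  proof -
    have "K * n - n * Z = 0 \<longleftrightarrow> dconj (K * n - n * Z) = 0"
      by (auto simp: dconj_def dquat_eq_iff quat_eq_iff)
    then show ?thesis using conj[OF that] by auto
  qed
  have 2: "primal (K * n - n * Z) = 0 \<longleftrightarrow> primal m * primal K = primal Z * primal m"
    if "K \<in> \<S> UNIV" for K
  proof -
    have "primal (K * n - n * Z) = 0 \<longleftrightarrow> primal (dconj (K * n - n * Z)) = 0"
      by (auto simp: dconj_def quat_eq_iff)
    then show ?thesis unfolding conj[OF that] by auto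
  qed
  show ?thesis
    unfolding zeros_def prod dquat_mult_eq_0_iff using 1 2 by blast
qed

section \<open>Compatibility of \<open>\<C>\<close> with the sphere, real scaling and primal
  parts\<close>

lemma \<C>_unit_sphere:
  assumes "J \<in> \<S> UNIV"
  shows "\<C> h J \<in> \<S> UNIV"
proof -
  have *: "inverse k * J * k \<in> \<S> UNIV" if "primal k \<noteq> 0" for k
  proof -
    have "(inverse k * J * k) * (inverse k * J * k) = inverse k * (J * (k * inverse k) * J) * k"
      by (simp only: mult.assoc)
    also have "\<dots> = - 1"
      using dquat_inverse[OF that] assms by (simp add: unit_sphere_iff)
    finally show ?thesis by (simp add: unit_sphere_iff)
  qed
  show ?thesis
    using *[of h] *[of "of_quat (dualp h)"] assms by (auto simp: \<C>_def dquat_eq_iff)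
qed

text \<open>If \<open>primal h = 0\<close>, then \<open>\<C>\<close> conjugates by the quaternion
  \<open>of_quat (dualp h)\<close> or, for \<open>h = 0\<close>, does nothing.\<close>

lemma \<C>_quats:
  assumes "J \<in> \<bbbH>" "h \<in> \<bbbH> \<or> primal h = 0"
  shows "\<C> h J \<in> \<bbbH>"
  using assms by (auto simp: \<C>_def quats_iff dquat_eq_iff inverse_dquat_def)

text \<open>This absorbs the factor \<open>1 / \<beta>\<close> between a spherical derivative and
  the stem component.\<close>

lemma \<C>_scaleR:
  assumes "r \<noteq> 0"
  shows "\<C> (r *\<^sub>R h) l = \<C> h l"
proof -
  have "inverse (r *\<^sub>R k) * l * (r *\<^sub>R k) = inverse k * l * k" for k
    using assms by (simp add: dquat_eq_iff inverse_dquat_def inverse_scaleR_distrib algebra_simps)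
  moreover have "of_quat (r *\<^sub>R q) = r *\<^sub>R of_quat q" for q
    by (simp add: dquat_eq_iff)
  moreover have "r *\<^sub>R h = 0 \<longleftrightarrow> h = 0" "primal (r *\<^sub>R h) = 0 \<longleftrightarrow> primal h = 0"
    using assms by auto
  ultimately show ?thesis unfolding \<C>_def by simp
qed

lemma \<C>_affine: "\<C> h (of_real \<alpha> + \<beta> *\<^sub>R J) = of_real \<alpha> + \<beta> *\<^sub>R \<C> h J"
proof -
  have "inverse k * (of_real \<alpha> + \<beta> *\<^sub>R J) * k = of_real \<alpha> + \<beta> *\<^sub>R (inverse k * J * k)"
    if "primal k \<noteq> 0" for k
    using dquat_inverse[OF that] by (simp add: of_real_def distrib_left distrib_right)
  moreover have "primal (of_quat (dualp h)) \<noteq> 0" if "primal h = 0" "h \<noteq> 0"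
    using that by (simp add: dquat_eq_iff)
  ultimately show ?thesis unfolding \<C>_def by simp
qed

text \<open>The primal part is a ring homomorphism. For \<open>primal h = 0\<close> the right side
  would fall into the default branch and be \<open>\<pi> l\<close>.\<close>

lemma primal_\<C>: "primal h \<noteq> 0 \<Longrightarrow> \<pi> (\<C> h l) = \<C> (\<pi> h) (\<pi> l)"
  by (simp add: \<C>_def inverse_dquat_def dquat_eq_iff)

section \<open>Zero sets of products, sorted by the zero sets of the factors\<close>

text \<open>Here \<open>b\<close> is a nonzero multiple of \<open>\<epsilon>\<close>, so the factor
  \<open>b * e\<close> split off has primal part 0, which excludes singletons, and it vanishes with
  \<open>primal e\<close>.\<close>

lemma zeros_mult_fibre:
  assumes J: "J \<in> \<S> UNIV" "J \<in> \<bbbH>" and eq: "zeros a b = fibre J"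
  shows "zeros (a * c - b * d) (a * d + b * c) =
    (if primal (c + \<C> b (- J) * d) = 0 then \<S> UNIV else fibre J)"
proof -
  have b: "primal b = 0" "b \<noteq> 0" using zeros_fibre[OF J(1) eq] by auto
  define e where "e = c + \<C> b (- J) * d"
  have m: "b * c - J * (b * d) = b * e"
    using \<C>_mult[of b "- J"] by (simp add: e_def distrib_left mult.assoc[symmetric])
  have "b * e = 0 \<longleftrightarrow> primal e = 0" using b by (auto simp: dquat_mult_eq_0_iff)
  moreover have "a + J * b = 0" using fibre_self[OF J(1)] eq by (auto simp: zeros_def)
  ultimately show ?thesis
    using zeros_mult_left[OF J(1), of a b c d, unfolded m] b(1) unfolding e_def by simp
qed

text \<open>Here \<open>b\<close> is invertible and cancels from
  \<open>b * (c + \<C> b (- J) * d)\<close>. The second test uses \<open>\<pi> b\<close> to fit the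
  spherical derivative of the primal function.\<close>

lemma zeros_mult_singleton:
  assumes "zeros a b = {J}"
  shows "zeros (a * c - b * d) (a * d + b * c) =
    (if c + \<C> b (- J) * d = 0 then \<S> UNIV
     else if primal (c + \<C> (\<pi> b) (- \<pi> J) * d) = 0 then fibre J else {J})"
proof -
  note J = zeros_singleton[OF assms]
  have "b * c - J * (b * d) = b * (c + \<C> b (- J) * d)"
    using \<C>_mult[of b "- J"] by (simp add: distrib_left mult.assoc[symmetric])
  moreover have "primal (\<C> b (- J)) = primal (\<C> (\<pi> b) (- \<pi> J))"
    using primal_\<C>[OF J(2), of "- J"] by (metis primal_part_simps(1,4))
  ultimately show ?thesis
    using J zeros_mult_left[of J a b c d] by (auto simp: dquat_mult_eq_0_iff)
qed

text \<open>The primal part of the sum is \<open>(primal W - primal Z) * primal d\<close>, with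
  \<open>primal d\<close> nonzero.\<close>

lemma zeros_singleton_primal:
  assumes "zeros c d = {Z}"
  shows "primal (c + W * d) = 0 \<longleftrightarrow> primal W = primal Z"
proof -
  note Z = zeros_singleton[OF assms]
  have "primal c = - (primal Z * primal d)"
    using Z(3) by (simp add: dquat_eq_iff eq_neg_iff_add_eq_0)
  then have "primal (c + W * d) = (primal W - primal Z) * primal d"
    by (simp add: left_diff_distrib)
  then show ?thesis using Z(2) by simp
qed

text \<open>A zero \<open>Z\<close> of the conjugate function would yield the zero
  \<open>\<C> (dconj b) (- Z)\<close> of the function itself.\<close>

lemma zeros_empty_conj:
  assumes "zeros a b = {}" "Z \<in> \<S> UNIV"
  shows "dconj a + Z * dconj b \<noteq> 0"
proof
  assume eq: "dconj a + Z * dconj b = 0"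
  define K where "K = \<C> (dconj b) (- Z)"
  have K: "K \<in> \<S> UNIV"
    using \<C>_unit_sphere[OF uminus_unit_sphere[OF assms(2)]] by (simp add: K_def)
  have "dconj b * K = - Z * dconj b" unfolding K_def by (rule \<C>_mult)
  with eq have "dconj a - dconj b * K = 0" by simp
  moreover have "dconj (a + K * b) = dconj a - dconj b * K" using dconj_unit_sphere[OF K] by simp
  ultimately have "dconj (a + K * b) = 0" by simp
  then have "a + K * b = 0" by (auto simp: dconj_def dquat_eq_iff quat_eq_iff)
  with K assms(1) show False by (auto simp: zeros_def)
qed

text \<open>As \<open>d\<close> is a nonzero multiple of \<open>\<epsilon>\<close>, only the primal
  part of \<open>m * K = Z * m\<close> matters; it is void or determines
  \<open>primal K\<close>.\<close>

lemma zeros_mult_right_fibre: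
  fixes a b c d :: dquat
  assumes Z: "Z \<in> \<S> UNIV" and eq: "zeros c d = fibre Z"
  defines "m \<equiv> dconj a + Z * dconj b"
  shows "zeros (a * c - b * d) (a * d + b * c) =
    (if primal m = 0 then \<S> UNIV else fibre (\<C> (\<pi> m) Z))"
proof -
  have "Z \<in> zeros c d" using fibre_self[OF Z] eq by simp
  then have "c + Z * d = 0" by (simp add: zeros_def)
  note R = zeros_mult_right[OF Z this, of a b, folded m_def]
  have "primal d = 0" "d \<noteq> 0" using zeros_fibre[OF Z eq] by auto
  then have "zeros (a * c - b * d) (a * d + b * c) =
      {K \<in> \<S> UNIV. primal m * primal K = primal Z * primal m}"
    unfolding R by (auto simp: dquat_eq_iff)
  also have "\<dots> = (if primal m = 0 then \<S> UNIV else fibre (\<C> (\<pi> m) Z))"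
  proof (cases "primal m = 0")
    case False
    then have "primal m * primal (\<C> (\<pi> m) Z) = primal Z * primal m"
      using \<C>_mult[of "\<pi> m" Z] by (simp add: dquat_eq_iff)
    with False have "primal m * primal K = primal Z * primal m \<longleftrightarrow> primal K = primal (\<C> (\<pi> m) Z)" for K
      by (metis mult_left_cancel)
    with False show ?thesis by (simp add: fibre_def)
  qed simp
  finally show ?thesis .
qed

text \<open>As \<open>primal d\<close> is nonzero, the full equation \<open>m * K = Z * m\<close>
  remains, with \<open>m \<noteq> 0\<close>. It determines \<open>K\<close> if \<open>m\<close> is
  invertible, and otherwise only \<open>primal K\<close>.\<close>

lemma zeros_mult_right_singleton:
  fixes a b c d :: dquat
  assumes eq: "zeros c d = {Z}" and nz: "zeros a b = {}"
  defines "m \<equiv> dconj a + Z * dconj b"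
  shows "zeros (a * c - b * d) (a * d + b * c) =
    (if primal m = 0 then fibre (\<C> m (\<pi> Z)) else {\<C> m Z})"
proof -
  note Z = zeros_singleton[OF eq]
  have m: "m \<noteq> 0" using zeros_empty_conj[OF nz Z(1)] by (simp add: m_def)
  have R: "zeros (a * c - b * d) (a * d + b * c) = {K \<in> \<S> UNIV. m * K = Z * m}"
    unfolding zeros_mult_right[OF Z(1,3), of a b, folded m_def] using Z(2) by auto
  show ?thesis
  proof (cases "primal m = 0")
    case True
    then have "dualp m \<noteq> 0" using m by (simp add: dquat_eq_iff)
    moreover have "dualp m * primal (\<C> m (\<pi> Z)) = primal Z * dualp m"
      using \<C>_dual(3)[OF True m, of "\<pi> Z"] by simp
    moreover have "m * K = Z * m \<longleftrightarrow> dualp m * primal K = primal Z * dualp m" for K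
      using True by (simp add: dquat_eq_iff)
    ultimately have "m * K = Z * m \<longleftrightarrow> primal K = primal (\<C> m (\<pi> Z))" for K
      by (metis mult_left_cancel)
    then show ?thesis using True by (simp add: R fibre_def)
  next
    case False
    then show ?thesis
      using dquat_inverse_conjugate_iff[OF False] \<C>_unit_sphere[OF Z(1), of m] unfolding R
      by (auto simp: \<C>_invertible(1))
  qed
qed

text \<open>The value at \<open>K\<close> factors as \<open>q * (c + \<C> q K * d)\<close> with
  \<open>q = a + K * b\<close>. Both factors are nonzero as values of zero-free functions, so both
  primal parts have to vanish.\<close>

lemma zeros_mult_empty:
  assumes "zeros a b = {}" "zeros c d = {}"
  shows "zeros (a * c - b * d) (a * d + b * c) =
    {K \<in> \<S> UNIV. primal (a + K * b) = 0 \<and> primal (c + \<C> (a + K * b) (\<pi> K) * d) = 0}"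
proof -
  have "a * c - b * d + K * (a * d + b * c) = 0 \<longleftrightarrow>
      primal (a + K * b) = 0 \<and> primal (c + \<C> (a + K * b) (\<pi> K) * d) = 0" if K: "K \<in> \<S> UNIV" for K
  proof -
    define q where "q = a + K * b"
    have q: "q \<noteq> 0" using assms(1) K by (auto simp: q_def zeros_def)
    have g: "c + \<C> q K * d \<noteq> 0" using assms(2) \<C>_unit_sphere[OF K] by (auto simp: zeros_def)
    have "a * c - b * d + K * (a * d + b * c) = q * c + K * q * d"
      using unit_square[OF K] by (simp add: q_def algebra_simps)
    also have "\<dots> = q * (c + \<C> q K * d)"
      using \<C>_mult[of q K] by (simp add: distrib_left mult.assoc[symmetric])
    finally have "a * c - b * d + K * (a * d + b * c) = 0 \<longleftrightarrow>
        primal q = 0 \<and> primal (c + \<C> q K * d) = 0"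
      using q g by (simp add: dquat_mult_eq_0_iff)
    \<comment> \<open>Now \<open>\<C>\<close> conjugates by a quaternion, so the dual part of
      \<open>K\<close> does not reach the primal part of the result.\<close>
    moreover have "primal (\<C> q K) = primal (\<C> q (\<pi> K))" if "primal q = 0"
      using that q by (simp add: \<C>_def inverse_dquat_def)
    ultimately show ?thesis by (auto simp: q_def)
  qed
  then show ?thesis unfolding zeros_def by blast
qed

lemma zeros_mult_sphere:
  assumes "zeros a b = \<S> UNIV \<or> zeros c d = \<S> UNIV"
  shows "zeros (a * c - b * d) (a * d + b * c) = \<S> UNIV"
  using assms by (auto simp: zeros_eq_sphere_iff)

section \<open>Slice functions on a sphere\<close>

definition pt :: "real \<Rightarrow> real \<Rightarrow> dquat \<Rightarrow> dquat" where
  "pt \<alpha> \<beta> J = of_real \<alpha> + \<beta> *\<^sub>R J"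

lemma inj_pt: "\<beta> \<noteq> 0 \<Longrightarrow> inj (pt \<alpha> \<beta>)"
  by (rule injI) (simp add: pt_def)

lemma sphere_of_pt:
  assumes "J \<in> \<S> UNIV"
  shows "sphere_of (pt \<alpha> \<beta> J) = pt \<alpha> \<beta> ` \<S> UNIV"
  using sphere_of_rep[OF assms] by (auto simp: pt_def)

lemma pt_in_\<Omega>: "Complex \<alpha> \<beta> \<in> D \<Longrightarrow> J \<in> \<S> UNIV \<Longrightarrow> pt \<alpha> \<beta> J \<in> \<Omega> D"
  unfolding pt_def \<Omega>_def by blast

lemma primal_part_pt: "\<pi> (pt \<alpha> \<beta> J) = pt \<alpha> \<beta> (\<pi> J)"
  by (simp add: pt_def)

lemma pt_in_quats: "\<beta> \<noteq> 0 \<Longrightarrow> pt \<alpha> \<beta> J \<in> \<bbbH> \<longleftrightarrow> J \<in> \<bbbH>"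
  by (simp add: pt_def quats_iff)

lemma dconj_pt: "J \<in> \<S> UNIV \<Longrightarrow> dconj (pt \<alpha> \<beta> J) = pt \<alpha> \<beta> (- J)"
  by (simp add: pt_def dconj_unit_sphere)

lemma \<C>_pt: "\<C> h (pt \<alpha> \<beta> J) = pt \<alpha> \<beta> (\<C> h J)"
  by (simp add: pt_def \<C>_affine)

text \<open>For \<open>\<gamma> = \<beta> q\<close>, orthogonality to the imaginary part says that
  \<open>q\<close> is tangent at the base point, that is, that \<open>DQuat p q\<close> lies on the
  sphere.\<close>

lemma T_pt:
  assumes J: "J \<in> \<S> UNIV" "J \<in> \<bbbH>" and "\<beta> \<noteq> 0"
  shows "T (pt \<alpha> \<beta> J) = pt \<alpha> \<beta> ` fibre J"
proof -
  obtain p where p: "J = DQuat p 0" using J(2) by (auto simp: quats_def of_quat_def)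
  have imag: "imag (pt \<alpha> \<beta> J) = \<beta> *\<^sub>R J"
    using conj_imag_rep(2)[OF J(1)] by (simp add: pt_def)
  have p0: "qre p = 0" using J(1) by (simp add: p unit_sphere_coords)
  have perp: "perp (of_quat (\<beta> *\<^sub>R q)) (\<beta> *\<^sub>R J) \<and> qre q = 0 \<longleftrightarrow> DQuat p q \<in> \<S> UNIV" for q
  proof -
    have "perp (of_quat (\<beta> *\<^sub>R q)) (\<beta> *\<^sub>R J) \<longleftrightarrow>
        qre ((\<beta> * \<beta>) *\<^sub>R (q * qconj p + p * qconj q)) = 0"
      using p0 by (simp add: perp_def p dconj_def dquat_eq_iff quat_eq_iff algebra_simps)
    also have "qre ((\<beta> * \<beta>) *\<^sub>R (q * qconj p + p * qconj q)) =
        (\<beta> * \<beta>) * (2 * (qi p * qi q + qj p * qj q + qk p * qk q))"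
      using p0 by (simp add: algebra_simps)
    finally show ?thesis using J(1) assms(3) by (auto simp: p unit_sphere_coords)
  qed
  have pt: "pt \<alpha> \<beta> (DQuat p q) = pt \<alpha> \<beta> J + \<epsilon> * of_quat (\<beta> *\<^sub>R q)" for q
    by (simp add: pt_def p dual_unit_def dquat_eq_iff)
  show ?thesis
  proof (intro equalityI subsetI)
    fix w assume "w \<in> T (pt \<alpha> \<beta> J)"
    then obtain r where r: "w = pt \<alpha> \<beta> J + \<epsilon> * of_quat r" "qre r = 0" "perp (of_quat r) (\<beta> *\<^sub>R J)"
      unfolding T_def imag im_quats_def by blast
    define q where "q = (1 / \<beta>) *\<^sub>R r"
    have "r = \<beta> *\<^sub>R q" using assms(3) by (simp add: q_def)
    then have "w = pt \<alpha> \<beta> (DQuat p q)" using r(1) pt[of q] by simp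
    moreover have "qre q = 0" using r(2) by (simp add: q_def)
    then have "DQuat p q \<in> fibre J" using r(3) perp[of q] \<open>r = \<beta> *\<^sub>R q\<close>
      unfolding fibre_def by (simp add: p)
    ultimately show "w \<in> pt \<alpha> \<beta> ` fibre J" by blast
  next
    fix w assume "w \<in> pt \<alpha> \<beta> ` fibre J"
    then obtain K where K: "w = pt \<alpha> \<beta> K" "K \<in> \<S> UNIV" "primal K = p"
      by (auto simp: fibre_def p)
    then have KK: "K = DQuat p (dualp K)" by (simp add: dquat_eq_iff)
    then have "perp (of_quat (\<beta> *\<^sub>R dualp K)) (\<beta> *\<^sub>R J) \<and> qre (dualp K) = 0"
      using perp[of "dualp K"] K(2) by metis
    then have "perp (of_quat (\<beta> *\<^sub>R dualp K)) (\<beta> *\<^sub>R J)" "qre (\<beta> *\<^sub>R dualp K) = 0"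
      by simp_all
    moreover have "w = pt \<alpha> \<beta> J + \<epsilon> * of_quat (\<beta> *\<^sub>R dualp K)"
      using pt[of "dualp K"] K(1) KK by metis
    ultimately show "w \<in> T (pt \<alpha> \<beta> J)" unfolding T_def imag im_quats_def by blast
  qed
qed

section \<open>Values of the derived functions on a sphere\<close>

lemma stem_mult: "stem D F \<Longrightarrow> stem D G \<Longrightarrow> stem D (\<lambda>z. F z * G z)"
  by (simp add: stem_def times_dquatC_def)

lemma stem_conjC: "stem D F \<Longrightarrow> stem D (\<lambda>z. conjC (F z))"
  by (simp add: stem_def conjC_def)

lemma stem_primalC: "stem D F \<Longrightarrow> stem D (\<lambda>z. primalC (F z))"
  by (simp add: stem_def primalC_def)

lemma slice_function_pt:
  assumes "f \<in> slice_functions D" "Complex \<alpha> \<beta> \<in> D" "J \<in> \<S> UNIV"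
  shows "f (pt \<alpha> \<beta> J) =
    re\<iota> (stem_of D f (Complex \<alpha> \<beta>)) + J * im\<iota> (stem_of D f (Complex \<alpha> \<beta>))"
  using induced_apply[OF stem_of(1)[OF assms(1)] assms(2,3)] stem_of(2)[OF assms(1)]
    pt_in_\<Omega>[OF assms(2,3)] by (simp add: pt_def)

lemma slice_mult_pt:
  assumes "f \<in> slice_functions D" "g \<in> slice_functions D" "Complex \<alpha> \<beta> \<in> D" "J \<in> \<S> UNIV"
  defines "F \<equiv> stem_of D f (Complex \<alpha> \<beta>)" and "G \<equiv> stem_of D g (Complex \<alpha> \<beta>)"
  shows "slice_mult D f g (pt \<alpha> \<beta> J) =
    (re\<iota> F * re\<iota> G - im\<iota> F * im\<iota> G) + J * (re\<iota> F * im\<iota> G + im\<iota> F * re\<iota> G)"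
  using induced_apply[OF stem_mult[OF stem_of(1)[OF assms(1)] stem_of(1)[OF assms(2)]] assms(3,4)]
  by (simp add: slice_mult_def pt_def F_def G_def times_dquatC_def)

lemma slice_conj_pt:
  assumes "f \<in> slice_functions D" "Complex \<alpha> \<beta> \<in> D" "J \<in> \<S> UNIV"
  shows "slice_conj D f (pt \<alpha> \<beta> J) =
    dconj (re\<iota> (stem_of D f (Complex \<alpha> \<beta>))) + J * dconj (im\<iota> (stem_of D f (Complex \<alpha> \<beta>)))"
  using induced_apply[OF stem_conjC[OF stem_of(1)[OF assms(1)]] assms(2,3)]
  by (simp add: slice_conj_def pt_def conjC_def)

lemma slice_primal_pt:
  assumes "f \<in> slice_functions D" "Complex \<alpha> \<beta> \<in> D" "J \<in> \<S> UNIV" "J \<in> \<bbbH>"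
  shows "slice_primal D f (pt \<alpha> \<beta> J) =
    \<pi> (re\<iota> (stem_of D f (Complex \<alpha> \<beta>))) + J * \<pi> (im\<iota> (stem_of D f (Complex \<alpha> \<beta>)))"
  using induced_apply[OF stem_primalC[OF stem_of(1)[OF assms(1)]] assms(2), of J \<bbbH>] assms(3,4)
  by (simp add: slice_primal_def pt_def primalC_def unit_sphere_quats)

lemma slice_conj_slice_function:
  assumes "f \<in> slice_functions D"
  shows "slice_conj D f \<in> slice_functions D"
  using stem_conjC[OF stem_of(1)[OF assms]]
  unfolding slice_functions_def slice_conj_def by blast

text \<open>\<open>stem_of\<close> is only a choice, so its value is identified through
  \<open>stem_unique\<close>.\<close>

lemma stem_of_slice_conj:
  assumes "f \<in> slice_functions D" "cnj ` D = D" "z \<in> D"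
  shows "stem_of D (slice_conj D f) z = conjC (stem_of D f z)"
  using stem_unique[OF stem_of(1)[OF slice_conj_slice_function[OF assms(1)]]
      stem_conjC[OF stem_of(1)[OF assms(1)]] _ assms(2,3)]
    stem_of(2)[OF slice_conj_slice_function[OF assms(1)]]
  by (simp add: slice_conj_def)

lemma V_sphere:
  assumes "Complex \<alpha> \<beta> \<in> D" "\<And>J. J \<in> \<S> UNIV \<Longrightarrow> h (pt \<alpha> \<beta> J) = a + J * b"
  shows "V D h \<inter> pt \<alpha> \<beta> ` \<S> UNIV = pt \<alpha> \<beta> ` zeros a b"
  using assms pt_in_\<Omega>[OF assms(1)] by (auto simp: V_def zeros_def)

text \<open>The difference of values is \<open>2 *\<^sub>R (J * b)\<close> and \<open>imag\<close>
  gives \<open>\<beta> *\<^sub>R J\<close>, so \<open>J\<close> cancels. An arbitrary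
  \<open>h\<close> covers both \<open>f\<close> and its primal function.\<close>

lemma spherical_deriv_pt:
  assumes "\<beta> \<noteq> 0" "J \<in> \<S> UNIV"
    and "h (pt \<alpha> \<beta> J) = a + J * b" "h (pt \<alpha> \<beta> (- J)) = a - J * b"
  shows "spherical_deriv h (pt \<alpha> \<beta> J) = (1 / \<beta>) *\<^sub>R b"
proof -
  have J: "primal J \<noteq> 0" using assms(2) by (auto simp: unit_sphere_iff dquat_eq_iff)
  then have k: "primal (\<beta> *\<^sub>R J) \<noteq> 0" using assms(1) by simp
  have "h (pt \<alpha> \<beta> J) - h (dconj (pt \<alpha> \<beta> J)) = 2 *\<^sub>R (J * b)"
    using assms(2-4) by (simp add: dconj_pt scaleR_2)
  also have "\<dots> = (2 / \<beta>) *\<^sub>R ((\<beta> *\<^sub>R J) * b)" using assms(1) by simp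
  finally show ?thesis
    using dquat_inverse(2)[OF k] assms(1) conj_imag_rep(2)[OF assms(2), of \<alpha> \<beta>]
    unfolding spherical_deriv_def pt_def
    by (simp del: mult_scaleR_left add: mult.assoc[symmetric])
qed

section \<open>Real points\<close>

lemma stem_real_point:
  assumes "stem D F" "Complex \<alpha> 0 \<in> D"
  shows "im\<iota> (F (Complex \<alpha> 0)) = 0"
proof -
  have "cnj (Complex \<alpha> 0) = Complex \<alpha> 0" by (simp add: complex_eq_iff)
  then have "im\<iota> (F (Complex \<alpha> 0)) = - im\<iota> (F (Complex \<alpha> 0))"
    using assms unfolding stem_def by metis
  then have "2 *\<^sub>R im\<iota> (F (Complex \<alpha> 0)) = 0"
    unfolding scaleR_2 by (simp only: eq_neg_iff_add_eq_0)
  then show ?thesis by simp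
qed

text \<open>The odd stem components vanish at a real point, so the value is the plain product and
  \<open>dquat_mult_eq_0_iff\<close> gives the three alternatives.\<close>

lemma V_slice_mult_real:
  assumes f: "f \<in> slice_functions D" and g: "g \<in> slice_functions D" and x: "x \<in> \<Omega> D \<inter> \<real>"
  shows "x \<in> V D (slice_mult D f g) \<longleftrightarrow>
       x \<in> V D f \<union> V D g \<union> (V\<^sub>\<pi> D (slice_primal D f) \<inter> V\<^sub>\<pi> D (slice_primal D g))"
proof -
  obtain \<alpha> \<beta> J0 where 0: "Complex \<alpha> \<beta> \<in> D" "J0 \<in> \<S> UNIV" "x = pt \<alpha> \<beta> J0"
    using x unfolding \<Omega>_def pt_def by blast
  obtain r where "x = of_real r" using x by (auto elim: Reals_cases)
  with 0(3) have eq: "of_real \<alpha> + \<beta> *\<^sub>R J0 = of_real r + 0 *\<^sub>R J0" by (simp add: pt_def)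
  then have \<beta>: "\<beta> = 0" using unit_sphere_rep_unique(2)[OF 0(2,2) eq] by auto
  \<comment> \<open>Since \<open>\<beta> = 0\<close>, any unit represents \<open>x\<close>; the
    primal functions need a quaternionic one.\<close>
  define J where "J = \<pi> J0"
  have J: "J \<in> \<S> UNIV" "J \<in> \<bbbH>" using primal_part_unit_sphere[OF 0(2)] by (auto simp: J_def)
  have xJ: "x = pt \<alpha> 0 J" using 0(3) \<beta> by (simp add: pt_def)
  have D: "Complex \<alpha> 0 \<in> D" using 0(1) \<beta> by simp
  have "x \<in> \<bbbH>" by (simp add: xJ pt_def quats_iff)
  moreover have "x \<in> \<Omega> D" using x by simp
  moreover note slice_function_pt[OF f D J(1), folded xJ] slice_function_pt[OF g D J(1), folded xJ]
    slice_primal_pt[OF f D J, folded xJ] slice_primal_pt[OF g D J, folded xJ]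
    slice_mult_pt[OF f g D J(1), folded xJ]
    stem_real_point[OF stem_of(1)[OF f] D] stem_real_point[OF stem_of(1)[OF g] D]
  ultimately show ?thesis
    by (simp add: V_def V\<^sub>\<pi>_def dquat_mult_eq_0_iff primal_part_eq_0_iff)
      (auto simp: dquat_eq_iff)
qed

section \<open>Zero sets of products of slice functions\<close>

theorem theorem6p4:
  fixes D :: "complex set" and f g :: "dquat \<Rightarrow> dquat"
  assumes "cnj ` D = D"
    and "f \<in> slice_functions D" and "g \<in> slice_functions D"
  shows
   "(\<forall>x \<in> \<Omega> D \<inter> \<real>. x \<in> V D (slice_mult D f g) \<longleftrightarrow>
       x \<in> V D f \<union> V D g \<union> (V\<^sub>\<pi> D (slice_primal D f) \<inter> V\<^sub>\<pi> D (slice_primal D g))) \<and>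
    (\<forall>x \<in> \<Omega> D - \<real>.
      \<comment> \<open>1\<close>
      (V D f \<supseteq> sphere_of x \<or> V D g \<supseteq> sphere_of x \<longrightarrow>
         V D (slice_mult D f g) \<supseteq> sphere_of x) \<and>
      \<comment> \<open>2\<close>
      (\<forall>y1 \<in> sphere_of x \<inter> \<bbbH>. \<forall>z1 \<in> sphere_of x \<inter> \<bbbH>.
         V D f \<inter> sphere_of x = T y1 \<and> V D g \<inter> sphere_of x = T z1 \<longrightarrow>
         V D (slice_mult D f g) \<supseteq> sphere_of x) \<and>
      \<comment> \<open>3\<close>
      (\<forall>y1 \<in> sphere_of x \<inter> \<bbbH>. \<forall>z \<in> sphere_of x.
         V D f \<inter> sphere_of x = T y1 \<and> V D g \<inter> sphere_of x = {z} \<longrightarrow>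
         (if \<pi> z = \<C> (spherical_deriv f x) (dconj y1)
          then V D (slice_mult D f g) \<supseteq> sphere_of x
          else V D (slice_mult D f g) \<inter> sphere_of x = T y1)) \<and>
      \<comment> \<open>4\<close>
      (\<forall>y1 \<in> sphere_of x \<inter> \<bbbH>.
         V D f \<inter> sphere_of x = T y1 \<and> V D g \<inter> sphere_of x = {} \<longrightarrow>
         (if \<C> (spherical_deriv f x) (dconj y1) \<in> V\<^sub>\<pi> D (slice_primal D g)
          then V D (slice_mult D f g) \<supseteq> sphere_of x
          else V D (slice_mult D f g) \<inter> sphere_of x = T y1)) \<and>
      \<comment> \<open>5\<close>
      (\<forall>y \<in> sphere_of x. \<forall>z1 \<in> sphere_of x \<inter> \<bbbH>.
         V D f \<inter> sphere_of x = {y} \<and> V D g \<inter> sphere_of x = T z1 \<longrightarrow>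
         (if z1 = \<C> (spherical_deriv (slice_primal D f) (\<pi> x)) (dconj (\<pi> y))
          then V D (slice_mult D f g) \<supseteq> sphere_of x
          else V D (slice_mult D f g) \<inter> sphere_of x = T (\<pi> y))) \<and>
      \<comment> \<open>6\<close>
      (\<forall>y \<in> sphere_of x. \<forall>z \<in> sphere_of x.
         V D f \<inter> sphere_of x = {y} \<and> V D g \<inter> sphere_of x = {z} \<longrightarrow>
         (if z = \<C> (spherical_deriv f x) (dconj y)
          then V D (slice_mult D f g) \<supseteq> sphere_of x
          else if z \<in> T (\<C> (spherical_deriv (slice_primal D f) (\<pi> x)) (dconj (\<pi> y)))
          then V D (slice_mult D f g) \<inter> sphere_of x = T (\<pi> y)
          else V D (slice_mult D f g) \<inter> sphere_of x = {y})) \<and>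
      \<comment> \<open>7\<close>
      (\<forall>y \<in> sphere_of x.
         V D f \<inter> sphere_of x = {y} \<and> V D g \<inter> sphere_of x = {} \<longrightarrow>
         (if \<C> (spherical_deriv (slice_primal D f) (\<pi> x)) (dconj (\<pi> y)) \<in> V\<^sub>\<pi> D (slice_primal D g)
          then V D (slice_mult D f g) \<inter> sphere_of x = T (\<pi> y)
          else V D (slice_mult D f g) \<inter> sphere_of x = {y})) \<and>
      \<comment> \<open>8\<close>
      (\<forall>z1 \<in> sphere_of x \<inter> \<bbbH>.
         V D f \<inter> sphere_of x = {} \<and> V D g \<inter> sphere_of x = T z1 \<longrightarrow>
         (if z1 \<in> V\<^sub>\<pi> D (slice_primal D (slice_conj D f))
          then V D (slice_mult D f g) \<supseteq> sphere_of x
          else V D (slice_mult D f g) \<inter> sphere_of x =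
                 T (\<C> (slice_primal D (slice_conj D f) z1) z1))) \<and>
      \<comment> \<open>9\<close>
      (\<forall>z \<in> sphere_of x.
         V D f \<inter> sphere_of x = {} \<and> V D g \<inter> sphere_of x = {z} \<longrightarrow>
         (if \<pi> z \<in> V\<^sub>\<pi> D (slice_primal D (slice_conj D f))
          then V D (slice_mult D f g) \<inter> sphere_of x = T (\<C> (slice_conj D f z) (\<pi> z))
          else V D (slice_mult D f g) \<inter> sphere_of x = {\<C> (slice_conj D f z) z})) \<and>
      \<comment> \<open>10\<close>
      (V D f \<inter> sphere_of x = {} \<and> V D g \<inter> sphere_of x = {} \<longrightarrow>
         V D (slice_mult D f g) \<inter> sphere_of x =
           {y \<in> sphere_of x. \<pi> y \<in> V\<^sub>\<pi> D (slice_primal D f) \<and>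
              \<C> (f y) (\<pi> y) \<in> V\<^sub>\<pi> D (slice_primal D g)}))"
proof (intro conjI ballI)
  fix x
  assume "x \<in> \<Omega> D \<inter> \<real>"
  then show "x \<in> V D (slice_mult D f g) \<longleftrightarrow>
      x \<in> V D f \<union> V D g \<union> (V\<^sub>\<pi> D (slice_primal D f) \<inter> V\<^sub>\<pi> D (slice_primal D g))"
    by (rule V_slice_mult_real[OF assms(2,3)])
next
  note f = assms(2) and g = assms(3)
  fix x
  assume x: "x \<in> \<Omega> D - \<real>"
  then obtain \<alpha> \<beta> J0 where D: "Complex \<alpha> \<beta> \<in> D" and J0: "J0 \<in> \<S> UNIV" and xJ0: "x = pt \<alpha> \<beta> J0"
    unfolding \<Omega>_def pt_def by blast
  have \<beta>: "\<beta> \<noteq> 0" using x xJ0 by (auto simp: pt_def)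
  define S where "S = \<S> (UNIV :: dquat set)"
  \<comment> \<open>Through the injective map \<open>p\<close> the claims on the sphere of
    \<open>x\<close> become claims about \<open>zeros\<close> on \<open>S\<close>.\<close>
  define p where "p = pt \<alpha> \<beta>"
  define a b c d where "a = re\<iota> (stem_of D f (Complex \<alpha> \<beta>))"
    and "b = im\<iota> (stem_of D f (Complex \<alpha> \<beta>))"
    and "c = re\<iota> (stem_of D g (Complex \<alpha> \<beta>))"
    and "d = im\<iota> (stem_of D g (Complex \<alpha> \<beta>))"
  define fg where "fg = slice_mult D f g"
  define P Q where "P = a * c - b * d" and "Q = a * d + b * c"
  have inj: "inj p" unfolding p_def using \<beta> by (rule inj_pt)
  have img: "p ` X = p ` Y \<longleftrightarrow> X = Y" "p ` X = {p J} \<longleftrightarrow> X = {J}" for X Y J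
    using inj_image_eq_iff[OF inj, of X Y] inj_image_eq_iff[OF inj, of X "{J}"] by auto
  have inj': "p J = p K \<longleftrightarrow> J = K" "p J \<in> p ` X \<longleftrightarrow> J \<in> X" for J K X
    using inj by (simp_all add: inj_eq inj_image_mem_iff)
  have sph: "sphere_of x = p ` S"
    unfolding xJ0 S_def p_def by (rule sphere_of_pt[OF J0])
  have val: "f (p J) = a + J * b" "g (p J) = c + J * d" "fg (p J) = P + J * Q"
    "slice_conj D f (p J) = dconj a + J * dconj b" if "J \<in> S" for J
    using slice_function_pt[OF f D] slice_function_pt[OF g D] slice_mult_pt[OF f g D]
      slice_conj_pt[OF f D] that
    by (simp_all add: S_def p_def a_def b_def c_def d_def P_def Q_def fg_def)
  note VS = V_sphere[OF D, folded p_def S_def]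
  have Z: "V D f \<inter> p ` S = p ` zeros a b" "V D g \<inter> p ` S = p ` zeros c d"
    "V D fg \<inter> p ` S = p ` zeros P Q"
    using VS[of f a b] VS[of g c d] VS[of fg P Q] val by simp_all
  have all: "p ` S \<subseteq> V D f \<longleftrightarrow> zeros a b = S" "p ` S \<subseteq> V D g \<longleftrightarrow> zeros c d = S"
    "p ` S \<subseteq> V D fg \<longleftrightarrow> zeros P Q = S"
    using Z img(1)[of _ S] by (metis inf.absorb_iff2 inf.cobounded1)+
  have primal_val: "slice_primal D f (p J) = \<pi> a + J * \<pi> b" "slice_primal D g (p J) = \<pi> c + J * \<pi> d"
    "slice_primal D (slice_conj D f) (p J) = \<pi> (dconj a) + J * \<pi> (dconj b)"
    if "J \<in> S" "J \<in> \<bbbH>" for J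
    using slice_primal_pt[OF f D] slice_primal_pt[OF g D]
      slice_primal_pt[OF slice_conj_slice_function[OF f] D] that
    unfolding stem_of_slice_conj[OF f assms(1) D]
    by (simp_all add: S_def p_def a_def b_def c_def d_def conjC_def)
  have pH: "p J \<in> \<bbbH> \<longleftrightarrow> J \<in> \<bbbH>" for J unfolding p_def using \<beta> by (rule pt_in_quats)
  \<comment> \<open>At a quaternionic \<open>J\<close> the primal function takes the primal part of
    the full value.\<close>
  have pV: "p J \<in> V\<^sub>\<pi> D (slice_primal D f) \<longleftrightarrow> primal (a + J * b) = 0"
    "p J \<in> V\<^sub>\<pi> D (slice_primal D g) \<longleftrightarrow> primal (c + J * d) = 0"
    "p J \<in> V\<^sub>\<pi> D (slice_primal D (slice_conj D f)) \<longleftrightarrow> primal (dconj a + J * dconj b) = 0"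
    if "J \<in> S" "J \<in> \<bbbH>" for J
  proof -
    have "p J \<in> \<Omega> D \<inter> \<bbbH>" using that pt_in_\<Omega>[OF D] pH by (simp add: S_def p_def)
    moreover have "dualp J = 0" using that(2) by (auto simp: quats_def)
    ultimately show "p J \<in> V\<^sub>\<pi> D (slice_primal D f) \<longleftrightarrow> primal (a + J * b) = 0"
      "p J \<in> V\<^sub>\<pi> D (slice_primal D g) \<longleftrightarrow> primal (c + J * d) = 0"
      "p J \<in> V\<^sub>\<pi> D (slice_primal D (slice_conj D f)) \<longleftrightarrow> primal (dconj a + J * dconj b) = 0"
      unfolding V\<^sub>\<pi>_def using primal_val[OF that] by (auto simp: dquat_eq_iff)
  qed
  have quat_pt: "\<exists>J. y = p J \<and> J \<in> S \<and> J \<in> \<bbbH>" if "y \<in> p ` S \<inter> \<bbbH>" for y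
    using that pH by auto
  have Sneg: "- J \<in> S" and S\<pi>: "\<pi> J \<in> S" "\<pi> J \<in> \<bbbH>" and SC: "\<C> h J \<in> S" if "J \<in> S" for J h
    using that uminus_unit_sphere primal_part_unit_sphere \<C>_unit_sphere by (auto simp: S_def)
  have negH: "- J \<in> \<bbbH> \<longleftrightarrow> J \<in> \<bbbH>" for J by (auto simp: quats_iff dquat_eq_iff)
  have \<pi>H: "\<pi> h \<in> \<bbbH>" for h by (simp add: quats_iff dquat_eq_iff)
  have Tp: "T (p J) = p ` fibre J" if "J \<in> S" "J \<in> \<bbbH>" for J
    using T_pt[OF _ that(2) \<beta>] that(1) by (simp add: S_def p_def)
  have fibre\<pi>: "fibre (\<pi> J) = fibre J" for J by (simp add: fibre_def)
  have Cp: "\<C> h (p J) = p (\<C> h J)" "\<pi> (p J) = p (\<pi> J)" for h J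
    by (simp_all add: p_def \<C>_pt primal_part_pt)
  have cp: "dconj (p J) = p (- J)" if "J \<in> S" for J
    using that by (simp add: S_def p_def dconj_pt)
  \<comment> \<open>Both spherical derivatives are nonzero real multiples of \<open>b\<close> and
    \<open>\<pi> b\<close>, which may replace them inside \<open>\<C>\<close>.\<close>
  have "spherical_deriv f x = (1 / \<beta>) *\<^sub>R b"
    unfolding xJ0 using val(1)[of J0] val(1)[OF Sneg, of J0] J0
    by (intro spherical_deriv_pt[OF \<beta> J0, where a = a]) (simp_all add: p_def S_def)
  then have Cf: "\<C> (spherical_deriv f x) l = \<C> b l" for l using \<beta> by (simp add: \<C>_scaleR)
  have "spherical_deriv (slice_primal D f) (\<pi> x) = (1 / \<beta>) *\<^sub>R \<pi> b"
    unfolding xJ0 primal_part_pt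
    using primal_val(1)[of "\<pi> J0"] primal_val(1)[OF Sneg, of "\<pi> J0"] S\<pi>[of J0] J0
    by (intro spherical_deriv_pt[OF \<beta>, where a = "\<pi> a"]) (simp_all add: p_def S_def negH)
  then have C\<pi>f: "\<C> (spherical_deriv (slice_primal D f) (\<pi> x)) l = \<C> (\<pi> b) l" for l
    using \<beta> by (simp add: \<C>_scaleR)
  note left_fibre = zeros_mult_fibre[of _ a b c d, folded P_def Q_def S_def]
  note left_single = zeros_mult_singleton[of a b _ c d, folded P_def Q_def S_def]
  note right_fibre = zeros_mult_right_fibre[of _ c d a b, folded P_def Q_def S_def]
  note right_single = zeros_mult_right_singleton[of c d _ a b, folded P_def Q_def S_def]

  show "V D f \<supseteq> sphere_of x \<or> V D g \<supseteq> sphere_of x \<longrightarrow>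
      V D (slice_mult D f g) \<supseteq> sphere_of x"
    using zeros_mult_sphere[of a b c d, folded P_def Q_def S_def]
    unfolding sph fg_def[symmetric] all by blast

  show "V D f \<inter> sphere_of x = T y1 \<and> V D g \<inter> sphere_of x = T z1 \<longrightarrow>
      V D (slice_mult D f g) \<supseteq> sphere_of x"
    if yz: "y1 \<in> sphere_of x \<inter> \<bbbH>" "z1 \<in> sphere_of x \<inter> \<bbbH>" for y1 z1
  proof -
    obtain J K where J: "y1 = p J" "J \<in> S" "J \<in> \<bbbH>" and K: "z1 = p K" "K \<in> S" "K \<in> \<bbbH>"
      using yz quat_pt unfolding sph by metis
    \<comment> \<open>Both \<open>c\<close> and \<open>d\<close> have primal part 0, so the test in
      \<open>left_fibre\<close> succeeds.\<close>
    have "zeros P Q = S" if "zeros a b = fibre J" "zeros c d = fibre K"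
      using left_fibre[OF _ J(3) that(1)] zeros_fibre[OF _ that(2)] J(2) K(2) by (simp add: S_def)
    then show ?thesis
      unfolding sph fg_def[symmetric] all Z J(1) K(1) Tp[OF J(2,3)] Tp[OF K(2,3)] img by blast
  qed

  show "V D f \<inter> sphere_of x = T y1 \<and> V D g \<inter> sphere_of x = {z} \<longrightarrow>
      (if \<pi> z = \<C> (spherical_deriv f x) (dconj y1)
       then V D (slice_mult D f g) \<supseteq> sphere_of x
       else V D (slice_mult D f g) \<inter> sphere_of x = T y1)"
    if yz: "y1 \<in> sphere_of x \<inter> \<bbbH>" "z \<in> sphere_of x" for y1 z
  proof -
    obtain J K where J: "y1 = p J" "J \<in> S" "J \<in> \<bbbH>" and K: "z = p K" "K \<in> S"
      using yz quat_pt unfolding sph by (metis imageE)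
    have "if \<pi> K = \<C> b (- J) then zeros P Q = S else zeros P Q = fibre J"
      if h: "zeros a b = fibre J" "zeros c d = {K}"
    proof -
      \<comment> \<open>Hence \<open>\<C> b (- J)\<close> is a quaternion and can be compared with
        \<open>\<pi> K\<close> by primal parts.\<close>
      have "primal b = 0" using zeros_fibre[OF _ h(1)] J(2) by (simp add: S_def)
      then have "\<C> b (- J) \<in> \<bbbH>" using J(3) by (simp add: \<C>_quats negH)
      then have "\<pi> K = \<C> b (- J) \<longleftrightarrow> primal (\<C> b (- J)) = primal K"
        by (auto simp: quats_iff dquat_eq_iff)
      then show ?thesis
        using left_fibre[OF _ J(3) h(1)] zeros_singleton_primal[OF h(2)] J(2) by (simp add: S_def)
    qed
    then show ?thesis
      unfolding sph fg_def[symmetric] all Z J(1) K(1) Cf Cp cp[OF J(2)] Tp[OF J(2,3)] img inj'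
      by blast
  qed

  show "V D f \<inter> sphere_of x = T y1 \<and> V D g \<inter> sphere_of x = {} \<longrightarrow>
      (if \<C> (spherical_deriv f x) (dconj y1) \<in> V\<^sub>\<pi> D (slice_primal D g)
       then V D (slice_mult D f g) \<supseteq> sphere_of x
       else V D (slice_mult D f g) \<inter> sphere_of x = T y1)"
    if y: "y1 \<in> sphere_of x \<inter> \<bbbH>" for y1
  proof -
    obtain J where J: "y1 = p J" "J \<in> S" "J \<in> \<bbbH>" using y quat_pt unfolding sph by metis
    have "if p (\<C> b (- J)) \<in> V\<^sub>\<pi> D (slice_primal D g) then zeros P Q = S else zeros P Q = fibre J"
      if h: "zeros a b = fibre J"
    proof -
      have "primal b = 0" using zeros_fibre[OF _ h] J(2) by (simp add: S_def)
      then have "\<C> b (- J) \<in> \<bbbH>" using J(3) by (simp add: \<C>_quats negH)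
      then show ?thesis
        using left_fibre[OF _ J(3) h] pV(2)[OF SC[OF Sneg]] J(2) by (simp add: S_def)
    qed
    then show ?thesis
      unfolding sph fg_def[symmetric] all Z J(1) Cf Cp cp[OF J(2)] Tp[OF J(2,3)] img
      by blast
  qed

  show "V D f \<inter> sphere_of x = {y} \<and> V D g \<inter> sphere_of x = T z1 \<longrightarrow>
      (if z1 = \<C> (spherical_deriv (slice_primal D f) (\<pi> x)) (dconj (\<pi> y))
       then V D (slice_mult D f g) \<supseteq> sphere_of x
       else V D (slice_mult D f g) \<inter> sphere_of x = T (\<pi> y))"
    if yz: "y \<in> sphere_of x" "z1 \<in> sphere_of x \<inter> \<bbbH>" for y z1
  proof -
    obtain J K where J: "y = p J" "J \<in> S" and K: "z1 = p K" "K \<in> S" "K \<in> \<bbbH>"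
      using yz quat_pt unfolding sph by (metis imageE)
    have "if K = \<C> (\<pi> b) (- \<pi> J) then zeros P Q = S else zeros P Q = fibre (\<pi> J)"
      if h: "zeros a b = {J}" "zeros c d = fibre K"
    proof -
      \<comment> \<open>This makes the primal test of \<open>left_single\<close> succeed, so its
        singleton branch is never reached.\<close>
      have "primal c = 0" "primal d = 0" using zeros_fibre[OF _ h(2)] K(2) by (simp_all add: S_def)
      moreover have "c + \<C> b (- J) * d = 0 \<longleftrightarrow> primal (\<C> b (- J)) = primal K"
        using h(2) SC[OF Sneg[OF J(2)]] by (auto simp: zeros_def fibre_def S_def)
      moreover have "\<pi> (\<C> b (- J)) = \<C> (\<pi> b) (- \<pi> J)"
        using primal_\<C>[OF zeros_singleton(2)[OF h(1)]] by simp
      then have "K = \<C> (\<pi> b) (- \<pi> J) \<longleftrightarrow> primal (\<C> b (- J)) = primal K"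
        using K(3) by (auto simp: quats_iff dquat_eq_iff)
      ultimately show ?thesis
        unfolding left_single[OF h(1)] fibre\<pi> by simp
    qed
    then show ?thesis
      unfolding sph fg_def[symmetric] all Z J(1) K(1) C\<pi>f Cp cp[OF S\<pi>(1)[OF J(2)]]
        Tp[OF S\<pi>[OF J(2)]] Tp[OF K(2,3)] img inj' by blast
  qed

  show "V D f \<inter> sphere_of x = {y} \<and> V D g \<inter> sphere_of x = {z} \<longrightarrow>
      (if z = \<C> (spherical_deriv f x) (dconj y)
       then V D (slice_mult D f g) \<supseteq> sphere_of x
       else if z \<in> T (\<C> (spherical_deriv (slice_primal D f) (\<pi> x)) (dconj (\<pi> y)))
       then V D (slice_mult D f g) \<inter> sphere_of x = T (\<pi> y)
       else V D (slice_mult D f g) \<inter> sphere_of x = {y})"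
    if yz: "y \<in> sphere_of x" "z \<in> sphere_of x" for y z
  proof -
    obtain J K where J: "y = p J" "J \<in> S" and K: "z = p K" "K \<in> S"
      using yz unfolding sph by blast
    define W where "W = \<C> (\<pi> b) (- \<pi> J)"
    have W: "W \<in> S" "W \<in> \<bbbH>"
      using SC[OF Sneg[OF S\<pi>(1)[OF J(2)]]] \<C>_quats[of "- \<pi> J" "\<pi> b"] by (simp_all add: W_def negH \<pi>H)
    have "if K = \<C> b (- J) then zeros P Q = S
        else if K \<in> fibre W then zeros P Q = fibre (\<pi> J) else zeros P Q = {J}"
      if h: "zeros a b = {J}" "zeros c d = {K}"
    proof -
      \<comment> \<open>Uniqueness of the zero of \<open>g\<close> turns the vanishing test into an
        equality.\<close>
      have "\<C> b (- J) \<in> zeros c d \<longleftrightarrow> K = \<C> b (- J)" unfolding h(2) by auto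
      then have "c + \<C> b (- J) * d = 0 \<longleftrightarrow> K = \<C> b (- J)"
        using SC[OF Sneg[OF J(2)]] by (simp add: zeros_def S_def)
      moreover have "primal (c + W * d) = 0 \<longleftrightarrow> K \<in> fibre W"
        unfolding zeros_singleton_primal[OF h(2)] using K(2) by (auto simp: fibre_def S_def)
      ultimately show ?thesis
        unfolding left_single[OF h(1), folded W_def] fibre\<pi> by simp
    qed
    then show ?thesis
      unfolding sph fg_def[symmetric] all Z J(1) K(1) Cf C\<pi>f Cp cp[OF J(2)] cp[OF S\<pi>(1)[OF J(2)]]
        W_def[symmetric] Tp[OF W] Tp[OF S\<pi>[OF J(2)]] img inj' by blast
  qed

  show "V D f \<inter> sphere_of x = {y} \<and> V D g \<inter> sphere_of x = {} \<longrightarrow>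
      (if \<C> (spherical_deriv (slice_primal D f) (\<pi> x)) (dconj (\<pi> y)) \<in> V\<^sub>\<pi> D (slice_primal D g)
       then V D (slice_mult D f g) \<inter> sphere_of x = T (\<pi> y)
       else V D (slice_mult D f g) \<inter> sphere_of x = {y})"
    if y: "y \<in> sphere_of x" for y
  proof -
    obtain J where J: "y = p J" "J \<in> S" using y unfolding sph by blast
    define W where "W = \<C> (\<pi> b) (- \<pi> J)"
    have W: "W \<in> S" "W \<in> \<bbbH>"
      using SC[OF Sneg[OF S\<pi>(1)[OF J(2)]]] \<C>_quats[of "- \<pi> J" "\<pi> b"] by (simp_all add: W_def negH \<pi>H)
    have "if p W \<in> V\<^sub>\<pi> D (slice_primal D g) then zeros P Q = fibre (\<pi> J) else zeros P Q = {J}"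
      if h: "zeros a b = {J}" "zeros c d = {}"
    proof -
      \<comment> \<open>As \<open>g\<close> has no zero on the sphere, the first branch of
        \<open>left_single\<close> is excluded.\<close>
      have "c + \<C> b (- J) * d \<noteq> 0"
        using h(2) SC[OF Sneg[OF J(2)]] by (auto simp: zeros_def S_def)
      then show ?thesis
        unfolding left_single[OF h(1), folded W_def] fibre\<pi> pV(2)[OF W] by simp
    qed
    then show ?thesis
      unfolding sph fg_def[symmetric] all Z J(1) C\<pi>f Cp cp[OF S\<pi>(1)[OF J(2)]]
        W_def[symmetric] Tp[OF S\<pi>[OF J(2)]] img image_is_empty by blast
  qed

  show "V D f \<inter> sphere_of x = {} \<and> V D g \<inter> sphere_of x = T z1 \<longrightarrow>
      (if z1 \<in> V\<^sub>\<pi> D (slice_primal D (slice_conj D f))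
       then V D (slice_mult D f g) \<supseteq> sphere_of x
       else V D (slice_mult D f g) \<inter> sphere_of x =
              T (\<C> (slice_primal D (slice_conj D f) z1) z1))"
    if z: "z1 \<in> sphere_of x \<inter> \<bbbH>" for z1
  proof -
    obtain K where K: "z1 = p K" "K \<in> S" "K \<in> \<bbbH>" using z quat_pt unfolding sph by metis
    \<comment> \<open>The value of the conjugate of \<open>f\<close> at \<open>p K\<close>; for
      quaternionic \<open>K\<close> its primal function has value \<open>\<pi> m\<close>
      there.\<close>
    define m where "m = dconj a + K * dconj b"
    have m: "slice_primal D (slice_conj D f) (p K) = \<pi> m"
      using primal_val(3)[OF K(2,3)] K(3) by (simp add: m_def quats_iff)
    have W: "\<C> (\<pi> m) K \<in> S" "\<C> (\<pi> m) K \<in> \<bbbH>"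
      using SC[OF K(2)] K(3) by (simp_all add: \<C>_quats \<pi>H)
    have "if primal m = 0 then zeros P Q = S else zeros P Q = fibre (\<C> (\<pi> m) K)"
      if "zeros c d = fibre K"
      using right_fibre[OF _ that, folded m_def] K(2) by (simp add: S_def)
    then show ?thesis
      unfolding sph fg_def[symmetric] all Z K(1) m Cp Tp[OF K(2,3)] Tp[OF W]
        pV(3)[OF K(2,3), folded m_def] img image_is_empty by blast
  qed

  show "V D f \<inter> sphere_of x = {} \<and> V D g \<inter> sphere_of x = {z} \<longrightarrow>
      (if \<pi> z \<in> V\<^sub>\<pi> D (slice_primal D (slice_conj D f))
       then V D (slice_mult D f g) \<inter> sphere_of x = T (\<C> (slice_conj D f z) (\<pi> z))
       else V D (slice_mult D f g) \<inter> sphere_of x = {\<C> (slice_conj D f z) z})"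
    if z: "z \<in> sphere_of x" for z
  proof -
    obtain K where K: "z = p K" "K \<in> S" using z unfolding sph by blast
    define m where "m = dconj a + K * dconj b"
    have m: "p (\<pi> K) \<in> V\<^sub>\<pi> D (slice_primal D (slice_conj D f)) \<longleftrightarrow> primal m = 0"
      using pV(3)[OF S\<pi>[OF K(2)]] by (simp add: m_def)
    have "if primal m = 0 then p ` zeros P Q = T (p (\<C> m (\<pi> K))) else p ` zeros P Q = {p (\<C> m K)}"
      if h: "zeros a b = {}" "zeros c d = {K}"
    proof (cases "primal m = 0")
      case True
      \<comment> \<open>With \<open>primal m = 0\<close>, \<open>\<C>\<close> acts through a
        quaternion or trivially, so the base point is quaternionic, as \<open>Tp\<close>
        requires.\<close>
      then have "\<C> m (\<pi> K) \<in> S" "\<C> m (\<pi> K) \<in> \<bbbH>"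
        using SC[OF S\<pi>(1)[OF K(2)]] S\<pi>(2)[OF K(2)] by (auto simp: \<C>_quats)
      then show ?thesis
        using right_single[OF h(2,1), folded m_def] True Tp by simp
    next
      case False
      then show ?thesis using right_single[OF h(2,1), folded m_def] by simp
    qed
    then show ?thesis
      unfolding sph fg_def[symmetric] all Z K(1) val(4)[OF K(2), folded m_def] Cp m
        img(2)[of "zeros c d"] image_is_empty by blast
  qed

  show "V D f \<inter> sphere_of x = {} \<and> V D g \<inter> sphere_of x = {} \<longrightarrow>
      V D (slice_mult D f g) \<inter> sphere_of x =
        {y \<in> sphere_of x. \<pi> y \<in> V\<^sub>\<pi> D (slice_primal D f) \<and>
           \<C> (f y) (\<pi> y) \<in> V\<^sub>\<pi> D (slice_primal D g)}"
  proof -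
    have key: "p (\<pi> K) \<in> V\<^sub>\<pi> D (slice_primal D f) \<and> p (\<C> (f (p K)) (\<pi> K)) \<in> V\<^sub>\<pi> D (slice_primal D g) \<longleftrightarrow>
        primal (a + K * b) = 0 \<and> primal (c + \<C> (a + K * b) (\<pi> K) * d) = 0" if K: "K \<in> S" for K
    proof -
      \<comment> \<open>Being quaternionic is ensured only under the first condition, which suffices
        because the second one is tested together with it.\<close>
      have "\<C> (a + K * b) (\<pi> K) \<in> S" "primal (a + K * b) = 0 \<longrightarrow> \<C> (a + K * b) (\<pi> K) \<in> \<bbbH>"
        using SC[OF S\<pi>(1)[OF K]] S\<pi>(2)[OF K] by (auto simp: \<C>_quats)
      then show ?thesis using val(1)[OF K] pV(1)[OF S\<pi>[OF K]] pV(2) by auto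
    qed
    have "p ` zeros P Q = {y \<in> p ` S. \<pi> y \<in> V\<^sub>\<pi> D (slice_primal D f) \<and>
        \<C> (f y) (\<pi> y) \<in> V\<^sub>\<pi> D (slice_primal D g)}" if "zeros a b = {}" "zeros c d = {}"
    proof -
      have "zeros P Q = {K \<in> S. p (\<pi> K) \<in> V\<^sub>\<pi> D (slice_primal D f) \<and>
          p (\<C> (f (p K)) (\<pi> K)) \<in> V\<^sub>\<pi> D (slice_primal D g)}"
        unfolding zeros_mult_empty[OF that, folded P_def Q_def S_def] using key by blast
      then show ?thesis by (auto simp: Cp)
    qed
    then show ?thesis
      unfolding sph fg_def[symmetric] Z image_is_empty by blast
  qed
qed

end
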